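(* Let $M$ be an untwisted hyperbolic punctured torus bundle with monodromy $h$ and fundamental group $\pi_1(M)\cong G\rtimes_{h_*}\mathbb{Z}$, where $G$ is the fundamental group of the punctured torus. Let $<$ be a bi-ordering of $\pi_1(M)$, and let $<_2$ be the bi-order on $G_2=[G,G]$ obtained by restricting $<$. Suppose that $C$ is a maximal convex subgroup of $G_2$ with respect to $<_2$. Then $C=G_3=[G_2,G]$.
   Context: A bi-ordering of a group is a strict total order on its elements that is invariant under left and right multiplication. A subgroup $C$ of a bi-ordered group $(H,<)$ is convex with respect to $<$ if for all $a,b\in C$ and $g\in H$, $a<g<b$ implies $g\in C$. A convex subgroup $C$ is maximal if $C\neq H$ and the only convex subgroups of $H$ containing $C$ are $C$ and $H$. Let $T$ be a compact oriented torus with one boundary component (the punctured torus), $x\in\partial T$ a base point and $G=\pi_1(T,x)$, a free group of rank 2. The punctured torus bundle with monodromy $h$, where $h\colon T\to T$ is an orientation-preserving homeomorphism fixing $\partial T$ pointwise, is $M=T\times[0,1]/((y,1)\sim(h(y),0))$. Let $h_*\in\mathrm{Aut}(G)$ be the induced automorphism and $h_+\in \mathrm{SL}(2,\mathbb{Z})$ the induced map on $H_1(T;\mathbb{Z})\cong\mathbb{Z}^2$. Then $\pi_1(M)\cong G\rtimes_{h_*}\mathbb{Z}$, and $G$ is regarded as the subgroup $G\times\{0\}$. The bundle is hyperbolic if $h$ is pseudo-Anosov (equivalently $|\mathrm{tr}\,h_+|>2$); a hyperbolic bundle is untwisted if the eigenvalues of $h_+$ are positive (equivalently $\mathrm{tr}\,h_+>2$)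 and twisted if they are negative. *)

theory Defs
  imports "HOL-Analysis.Analysis" "HOL-Homology.Homology" "HOL-Algebra.Generated_Groups"
begin

section \<open>Fundamental groups\<close>

definition path_class :: "'a::topological_space set \<Rightarrow> (real \<Rightarrow> 'a) \<Rightarrow> (real \<Rightarrow> 'a) set" where
  "path_class S p = {r. homotopic_paths S p r}"

text \<open>
  The product is defined on classes without choosing representatives: for loops p and q all the
  sets in the union coincide.
\<close>

definition fundamental_group :: "'a::topological_space set \<Rightarrow> 'a \<Rightarrow> (real \<Rightarrow> 'a) set monoid" where
  "fundamental_group S x =
     \<lparr>carrier = {path_class S p | p.
        path p \<and> path_image p \<subseteq> S \<and> pathstart p = x \<and> pathfinish p = x},
      monoid.mult = (\<lambda>a b. \<Union>p\<in>a. \<Union>r\<in>b. path_class S (p +++ r)),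
      one = path_class S (\<lambda>_. x)\<rparr>"

definition fundamental_group_map ::
    "('a::topological_space \<Rightarrow> 'b::topological_space) \<Rightarrow> 'b set \<Rightarrow> (real \<Rightarrow> 'a) set \<Rightarrow> (real \<Rightarrow> 'b) set"
  where "fundamental_group_map f S' a = (\<Union>p\<in>a. path_class S' (f \<circ> p))"

section \<open>Punctured torus bundles\<close>

text \<open>
  The standard model is the torus (the product of two unit circles) with the open disc
  Re z > 0, Re w > 0 (a product of two open half circles) removed.
\<close>

definition model_torus :: "(complex \<times> complex) set" where
  "model_torus = {(z, w). norm z = 1 \<and> norm w = 1 \<and> (Re z \<le> 0 \<or> Re w \<le> 0)}"

definition model_boundary :: "(complex \<times> complex) set" where
  "model_boundary =
     {(z, w). norm z = 1 \<and> norm w = 1 \<and> Re z \<ge> 0 \<and> Re w \<ge> 0 \<and> (Re z = 0 \<or> Re w = 0)}"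

definition punctured_torus :: "'t::topological_space set \<Rightarrow> 't set \<Rightarrow> bool" where
  "punctured_torus T B \<longleftrightarrow>
     (\<exists>f g. homeomorphism model_torus T f g \<and> B = f ` model_boundary)"

text \<open>
  The relative group in degree 2 is infinite cyclic, generated by a fundamental class, and
  preserving the orientation means fixing that class.
\<close>

definition orientation_preserving ::
    "'t::topological_space set \<Rightarrow> 't set \<Rightarrow> ('t \<Rightarrow> 't) \<Rightarrow> bool" where
  "orientation_preserving T B h \<longleftrightarrow>
     (\<forall>c \<in> carrier (relative_homology_group 2 (top_of_set T) B).
        hom_induced 2 (top_of_set T) B (top_of_set T) B h c = c)"

definition monodromy :: "'t::topological_space set \<Rightarrow> 't set \<Rightarrow> ('t \<Rightarrow> 't) \<Rightarrow> bool" where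
  "monodromy T B h \<longleftrightarrow>
     (\<exists>g. homeomorphism T T h g) \<and> (\<forall>y\<in>B. h y = y) \<and> orientation_preserving T B h"

text \<open>
  M is the quotient of the product of T with the unit interval by the equivalence relation
  generated by (y,1) ~ (h y,0); the map q is the projection.
\<close>

definition mapping_torus ::
    "'t::topological_space set \<Rightarrow> ('t \<Rightarrow> 't) \<Rightarrow> 'm::topological_space set \<Rightarrow> ('t \<times> real \<Rightarrow> 'm) \<Rightarrow> bool"
  where
  "mapping_torus T h M q \<longleftrightarrow>
     quotient_map (top_of_set (T \<times> {0..1})) (top_of_set M) q \<and>
     (\<forall>u \<in> T \<times> {0..1}. \<forall>v \<in> T \<times> {0..1}.
        q u = q v \<longleftrightarrow> equivclp (\<lambda>u v. \<exists>y\<in>T. u = (y, 1) \<and> v = (h y, 0)) u v)"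

text \<open>
  The copy of \<open>\<pi>\<^sub>1(T,x)\<close> in \<open>\<pi>\<^sub>1(M,q(x,0))\<close>, induced by the inclusion of the fibre over 0. Under
  the standard isomorphism with the semidirect product of \<open>\<pi>\<^sub>1(T,x)\<close> by the integers, this is
  the normal factor.
\<close>

definition fibre_subgroup ::
    "'t::topological_space set \<Rightarrow> 't \<Rightarrow> 'm::topological_space set \<Rightarrow> ('t \<times> real \<Rightarrow> 'm) \<Rightarrow>
     (real \<Rightarrow> 'm) set set" where
  "fibre_subgroup T x M q =
     fundamental_group_map (\<lambda>y. q (y, 0)) M ` carrier (fundamental_group T x)"

section \<open>The action on first homology\<close>

definition int_plane :: "(int^2) monoid" where
  "int_plane = \<lparr>carrier = UNIV, monoid.mult = (+), one = 0\<rparr>"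

definition represents_on_H1 :: "'t::topological_space set \<Rightarrow> ('t \<Rightarrow> 't) \<Rightarrow> int^2^2 \<Rightarrow> bool" where
  "represents_on_H1 T h A \<longleftrightarrow>
     (\<exists>\<psi> \<in> iso (homology_group 1 (top_of_set T)) int_plane.
        \<forall>c \<in> carrier (homology_group 1 (top_of_set T)).
          \<psi> (hom_induced 1 (top_of_set T) {} (top_of_set T) {} h c) = A *v \<psi> c)"

text \<open>
  For a once-punctured torus, the monodromy is (isotopic, not relative to the boundary, to) a
  pseudo-Anosov map exactly if its trace on first homology exceeds 2 in absolute value.
\<close>

definition hyperbolic :: "int^2^2 \<Rightarrow> bool" where
  "hyperbolic A \<longleftrightarrow> \<bar>trace A\<bar> > 2"

definition real_eigenvalue :: "real^2^2 \<Rightarrow> real \<Rightarrow> bool" where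
  "real_eigenvalue A c \<longleftrightarrow> (\<exists>v. v \<noteq> 0 \<and> A *v v = c *s v)"

text \<open>
  Real eigenvalues suffice: a hyperbolic matrix of determinant 1 has two distinct real eigenvalues.
\<close>

definition untwisted :: "int^2^2 \<Rightarrow> bool" where
  "untwisted A \<longleftrightarrow> (\<forall>c. real_eigenvalue (map_matrix real_of_int A) c \<longrightarrow> c > 0)"

section \<open>Bi-orderings and convex subgroups\<close>

definition bi_ordering :: "('a, 'b) monoid_scheme \<Rightarrow> ('a \<Rightarrow> 'a \<Rightarrow> bool) \<Rightarrow> bool" where
  "bi_ordering H lt \<longleftrightarrow>
     irreflp_on (carrier H) lt \<and> transp_on (carrier H) lt \<and> totalp_on (carrier H) lt \<and>
     (\<forall>a \<in> carrier H. \<forall>b \<in> carrier H. \<forall>g \<in> carrier H.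
        lt a b \<longrightarrow> lt (g \<otimes>\<^bsub>H\<^esub> a) (g \<otimes>\<^bsub>H\<^esub> b) \<and> lt (a \<otimes>\<^bsub>H\<^esub> g) (b \<otimes>\<^bsub>H\<^esub> g))"

definition restrict_order :: "('a \<Rightarrow> 'a \<Rightarrow> bool) \<Rightarrow> 'a set \<Rightarrow> 'a \<Rightarrow> 'a \<Rightarrow> bool" where
  "restrict_order lt S a b \<longleftrightarrow> a \<in> S \<and> b \<in> S \<and> lt a b"

definition convex_subgroup ::
    "('a, 'b) monoid_scheme \<Rightarrow> ('a \<Rightarrow> 'a \<Rightarrow> bool) \<Rightarrow> 'a set \<Rightarrow> bool" where
  "convex_subgroup H lt C \<longleftrightarrow>
     subgroup C H \<and> (\<forall>a\<in>C. \<forall>b\<in>C. \<forall>g \<in> carrier H. lt a g \<and> lt g b \<longrightarrow> g \<in> C)"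

definition maximal_convex_subgroup ::
    "('a, 'b) monoid_scheme \<Rightarrow> ('a \<Rightarrow> 'a \<Rightarrow> bool) \<Rightarrow> 'a set \<Rightarrow> bool" where
  "maximal_convex_subgroup H lt C \<longleftrightarrow>
     convex_subgroup H lt C \<and> C \<noteq> carrier H \<and>
     (\<forall>D. convex_subgroup H lt D \<and> C \<subseteq> D \<longrightarrow> D = C \<or> D = carrier H)"

definition commutator_subgroup :: "('a, 'b) monoid_scheme \<Rightarrow> 'a set \<Rightarrow> 'a set \<Rightarrow> 'a set" where
  "commutator_subgroup H K L =
     generate H {k \<otimes>\<^bsub>H\<^esub> l \<otimes>\<^bsub>H\<^esub> inv\<^bsub>H\<^esub> k \<otimes>\<^bsub>H\<^esub> inv\<^bsub>H\<^esub> l | k l. k \<in> K \<and> l \<in> L}"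

end

theory Submission
  imports Defs
begin

text \<open>
  By Hoelder's argument the convex subgroup \<open>C\<close> is the kernel of an order homomorphism
  \<open>\<rho> : G\<^sub>2 \<rightarrow> \<real>\<close> that is unique up to scaling. Conjugation by \<open>g\<close> preserves \<open>G\<^sub>2\<close> and the order, so it
  multiplies \<open>\<rho>\<close> by some \<open>\<lambda>(g) > 0\<close>, and \<open>ln \<circ> \<lambda>\<close> is a real character of the group generated by \<open>G\<close>
  and the stable letter. Its restriction to \<open>G\<close> is invariant under the monodromy; it factors through
  \<open>H\<^sub>1(T) = \<int>\<^sup>2\<close>, on which 1 is not an eigenvalue of the monodromy since the determinant is \<open>\<plusminus>1\<close> and the
  trace exceeds 2 in absolute value. So \<open>\<lambda> = 1\<close> on \<open>G\<close>, which says \<open>G\<^sub>3 \<subseteq> C\<close>. As \<open>G\<close> is generated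
  by two elements \<open>a\<close> and \<open>b\<close>, every element of \<open>G\<^sub>2\<close> is \<open>[a,b]\<^sup>k u\<close> with \<open>u \<in> G\<^sub>3\<close>, and
  \<open>\<rho>([a,b]) \<noteq> 0\<close>, which gives \<open>C \<subseteq> G\<^sub>3\<close>.

  The topology contributes two generators of \<open>G\<close>, the conjugation action of the stable letter, and
  the half of the Hurewicz theorem saying that characters of \<open>\<pi>\<^sub>1(T)\<close> factor through \<open>H\<^sub>1(T)\<close>.
\<close>

section \<open>Archimedean bi-ordered groups\<close>

text \<open>The obstacle is that the matrix of the monodromy acts on singular homology of
  \<open>T\<close>, whereas the order lives on the fundamental group of \<open>M\<close>. The bridge
  is the character ln \<lambda>. Conjugation preserves the order, so it scales \<rho> by a positive
  factor and the logarithm exists. Real factors commute, so \<lambda> takes the same value on g and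
  on its conjugate by the stable letter. Pulled back along the inclusion of the fibre, this is
  invariance under \<open>h\<close> of a character of the fundamental group of \<open>T\<close>.
  Such a character is compared with homology through its values on singular edges, which are paths
  with arbitrary ends; this is why paths, and not only loops, are evaluated in the fundamental
  group. The same evaluation serves for the two generators: the preimage of the model torus in the
  plane is a thickened square lattice, and the lift of a loop is cut into short pieces
  there.\<close>

locale bi_ordered_group = group H for H (structure) +
  fixes lt :: "'a \<Rightarrow> 'a \<Rightarrow> bool"
  assumes bi_ordering: "bi_ordering H lt"
begin

definition le :: "'a \<Rightarrow> 'a \<Rightarrow> bool" where "le a b \<longleftrightarrow> lt a b \<or> a = b"

lemma lt_irrefl: "a \<in> carrier H \<Longrightarrow> \<not> lt a a"
  using bi_ordering by (auto simp: bi_ordering_def irreflp_on_def)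

lemma lt_trans:
  "\<lbrakk>lt a b; lt b c; a \<in> carrier H; b \<in> carrier H; c \<in> carrier H\<rbrakk> \<Longrightarrow> lt a c"
  using bi_ordering unfolding bi_ordering_def transp_on_def by blast

lemma lt_total:
  "\<lbrakk>a \<in> carrier H; b \<in> carrier H\<rbrakk> \<Longrightarrow> lt a b \<or> a = b \<or> lt b a"
  using bi_ordering unfolding bi_ordering_def totalp_on_def by blast

lemma lt_mult_left:
  "\<lbrakk>lt a b; a \<in> carrier H; b \<in> carrier H; g \<in> carrier H\<rbrakk> \<Longrightarrow> lt (g \<otimes> a) (g \<otimes> b)"
  using bi_ordering unfolding bi_ordering_def by blast

lemma lt_mult_right:
  "\<lbrakk>lt a b; a \<in> carrier H; b \<in> carrier H; g \<in> carrier H\<rbrakk> \<Longrightarrow> lt (a \<otimes> g) (b \<otimes> g)"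
  using bi_ordering unfolding bi_ordering_def by blast

lemma le_refl [simp]: "le a a"
  by (simp add: le_def)

lemma lt_imp_le: "lt a b \<Longrightarrow> le a b"
  by (simp add: le_def)

lemma le_trans:
  "\<lbrakk>le a b; le b c; a \<in> carrier H; b \<in> carrier H; c \<in> carrier H\<rbrakk> \<Longrightarrow> le a c"
  unfolding le_def using lt_trans by blast

lemma not_le: "\<lbrakk>a \<in> carrier H; b \<in> carrier H\<rbrakk> \<Longrightarrow> \<not> le a b \<longleftrightarrow> lt b a"
  unfolding le_def using lt_total lt_trans lt_irrefl by blast

lemma lt_le_trans:
  "\<lbrakk>lt a b; le b c; a \<in> carrier H; b \<in> carrier H; c \<in> carrier H\<rbrakk> \<Longrightarrow> lt a c"
  unfolding le_def using lt_trans by blast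

lemma le_total: "\<lbrakk>a \<in> carrier H; b \<in> carrier H\<rbrakk> \<Longrightarrow> le a b \<or> le b a"
  unfolding le_def using lt_total by blast

lemma le_mult:
  assumes "le a b" "le c d" "a \<in> carrier H" "b \<in> carrier H" "c \<in> carrier H" "d \<in> carrier H"
  shows "le (a \<otimes> c) (b \<otimes> d)"
proof -
  have "le (a \<otimes> c) (b \<otimes> c)" "le (b \<otimes> c) (b \<otimes> d)"
    using assms lt_mult_left lt_mult_right unfolding le_def by blast+
  then show ?thesis
    using assms le_trans by (meson m_closed)
qed

lemma lt_mult:
  assumes "lt a b" "lt c d" "a \<in> carrier H" "b \<in> carrier H" "c \<in> carrier H" "d \<in> carrier H"
  shows "lt (a \<otimes> c) (b \<otimes> d)"
proof -
  have "lt (a \<otimes> c) (b \<otimes> c)" "lt (b \<otimes> c) (b \<otimes> d)"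
    using assms lt_mult_left lt_mult_right by blast+
  then show ?thesis
    using assms lt_trans by (meson m_closed)
qed

lemma lt_inv:
  assumes "lt a b" "a \<in> carrier H" "b \<in> carrier H"
  shows "lt (inv b) (inv a)"
proof -
  have "lt (inv b \<otimes> a \<otimes> inv a) (inv b \<otimes> b \<otimes> inv a)"
    using assms by (intro lt_mult_right lt_mult_left) auto
  then show ?thesis
    using assms by (simp add: m_assoc)
qed

lemma le_pow:
  assumes "le a b" "a \<in> carrier H" "b \<in> carrier H"
  shows "le (a [^] (n::nat)) (b [^] n)"
  using assms by (induction n) (auto intro: le_mult)

section \<open>Powers of products in a possibly non-abelian ordered group\<close>

lemma le_swap_pow:
  assumes "le (g \<otimes> h) (h \<otimes> g)" "g \<in> carrier H" "h \<in> carrier H"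
  shows "le (g [^] (k::nat) \<otimes> h) (h \<otimes> g [^] k)"
proof (induction k)
  case (Suc k)
  have "le (g [^] k \<otimes> (g \<otimes> h)) (g [^] k \<otimes> (h \<otimes> g))"
    by (rule le_mult[OF le_refl assms(1)]) (use assms in auto)
  moreover have "le (g [^] k \<otimes> h \<otimes> g) (h \<otimes> g [^] k \<otimes> g)"
    by (rule le_mult[OF Suc le_refl]) (use assms in auto)
  ultimately show ?case
    using assms le_trans[of "g [^] k \<otimes> (g \<otimes> h)" "g [^] k \<otimes> (h \<otimes> g)" "h \<otimes> g [^] k \<otimes> g"]
    by (simp add: m_assoc)
qed (use assms in auto)

lemma le_swap_pow':
  assumes "le (g \<otimes> h) (h \<otimes> g)" "g \<in> carrier H" "h \<in> carrier H"
  shows "le (g \<otimes> h [^] (k::nat)) (h [^] k \<otimes> g)"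
proof (induction k)
  case (Suc k)
  have "le (g \<otimes> h [^] k \<otimes> h) (h [^] k \<otimes> g \<otimes> h)"
    by (rule le_mult[OF Suc le_refl]) (use assms in auto)
  moreover have "le (h [^] k \<otimes> (g \<otimes> h)) (h [^] k \<otimes> (h \<otimes> g))"
    by (rule le_mult[OF le_refl assms(1)]) (use assms in auto)
  ultimately show ?case
    using assms le_trans[of "g \<otimes> h [^] k \<otimes> h" "h [^] k \<otimes> g \<otimes> h" "h [^] k \<otimes> (h \<otimes> g)"]
    by (simp add: m_assoc)
qed (use assms in auto)

text \<open>Replacing an adjacent \<open>g \<otimes> h\<close> by \<open>h \<otimes> g\<close> can
  only increase a word. Among the words with k letters of each kind,
  \<open>g [^] k \<otimes> h [^] k\<close> is therefore a lower and
  \<open>h [^] k \<otimes> g [^] k\<close> an upper bound. This stands in for commutativity in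
  Hoelder's argument.\<close>

lemma pow_mult_between:
  assumes "le (g \<otimes> h) (h \<otimes> g)" and gh: "g \<in> carrier H" "h \<in> carrier H"
  shows "le (g [^] (k::nat) \<otimes> h [^] k) ((g \<otimes> h) [^] k)"
    and "le ((h \<otimes> g) [^] k) (h [^] k \<otimes> g [^] k)"
proof -
  show "le (g [^] k \<otimes> h [^] k) ((g \<otimes> h) [^] k)"
  proof (induction k)
    case (Suc k)
    have "le (g [^] k \<otimes> (g \<otimes> h [^] k) \<otimes> h) (g [^] k \<otimes> (h [^] k \<otimes> g) \<otimes> h)"
      by (rule le_mult[OF le_mult[OF le_refl le_swap_pow'[OF assms]] le_refl]) (use gh in auto)
    moreover have "le (g [^] k \<otimes> h [^] k \<otimes> (g \<otimes> h)) ((g \<otimes> h) [^] k \<otimes> (g \<otimes> h))"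
      using assms Suc by (intro le_mult) auto
    ultimately show ?case
      using gh le_trans[of "g [^] k \<otimes> (g \<otimes> h [^] k) \<otimes> h" "g [^] k \<otimes> (h [^] k \<otimes> g) \<otimes> h"
          "(g \<otimes> h) [^] k \<otimes> (g \<otimes> h)"]
      by (simp add: m_assoc)
  qed auto
  show "le ((h \<otimes> g) [^] k) (h [^] k \<otimes> g [^] k)"
  proof (induction k)
    case (Suc k)
    have "le ((h \<otimes> g) [^] k \<otimes> (h \<otimes> g)) (h [^] k \<otimes> g [^] k \<otimes> (h \<otimes> g))"
      using assms Suc by (intro le_mult) auto
    moreover have "le (h [^] k \<otimes> (g [^] k \<otimes> h) \<otimes> g) (h [^] k \<otimes> (h \<otimes> g [^] k) \<otimes> g)"
      by (rule le_mult[OF le_mult[OF le_refl le_swap_pow[OF assms]] le_refl]) (use gh in auto)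
    ultimately show ?case
      using gh le_trans[of "(h \<otimes> g) [^] k \<otimes> (h \<otimes> g)" "h [^] k \<otimes> g [^] k \<otimes> (h \<otimes> g)"
          "h [^] k \<otimes> (h \<otimes> g [^] k) \<otimes> g"]
      by (simp add: m_assoc)
  qed auto
qed

lemma int_pow_strict_mono:
  assumes c: "c \<in> carrier H" "lt \<one> c" and "(m::int) < n"
  shows "lt (c [^] m) (c [^] n)"
proof -
  have pos: "lt \<one> (c [^] Suc k)" for k
  proof (induction k)
    case (Suc k)
    then have "lt (\<one> \<otimes> \<one>) (c [^] Suc k \<otimes> c)"
      using c by (intro lt_mult) auto
    then show ?case by simp
  qed (use c in auto)
  obtain k where k: "n = m + int (Suc k)"
    using \<open>m < n\<close> zless_iff_Suc_zadd by blast
  have "lt (c [^] m \<otimes> \<one>) (c [^] m \<otimes> c [^] Suc k)"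
    using c pos by (intro lt_mult_left) auto
  moreover have "c [^] n = c [^] m \<otimes> c [^] Suc k"
    unfolding k using c int_pow_mult int_pow_int by metis
  ultimately show ?thesis
    using c by simp
qed

lemma int_pow_mono_iff:
  assumes c: "c \<in> carrier H" "lt \<one> c"
  shows "le (c [^] (m::int)) (c [^] n) \<longleftrightarrow> m \<le> n"
  using int_pow_strict_mono[OF c, of m n] int_pow_strict_mono[OF c, of n m] c
    not_le[of "c [^] m" "c [^] n"] le_def lt_irrefl
  by (metis int_pow_closed linorder_neqE_linordered_idom order.order_iff_strict verit_comp_simplify1(3))

section \<open>Archimedean elements and Hoelder's homomorphism\<close>

definition archimedean :: "'a \<Rightarrow> bool" where
  "archimedean c \<longleftrightarrow> c \<in> carrier H \<and> lt \<one> c \<and>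
     (\<forall>g\<in>carrier H. \<exists>n::int. lt g (c [^] n))"

lemma archimedean_floor:
  assumes c: "archimedean c" and g: "g \<in> carrier H"
  obtains n :: int where "le (c [^] n) g" "lt g (c [^] (n + 1))"
proof -
  have c1: "c \<in> carrier H" "lt \<one> c" using c by (auto simp: archimedean_def)
  obtain u :: int where u: "lt g (c [^] u)"
    using c g by (auto simp: archimedean_def)
  obtain v :: int where v: "lt (inv g) (c [^] v)"
    using c g by (meson archimedean_def inv_closed)
  have lo: "lt (c [^] (-v)) g"
    using lt_inv[OF v] g c1 by (simp add: int_pow_neg)
  have "le (c [^] (-v)) (c [^] u)"
    using lo u g c1 lt_trans lt_imp_le by (meson int_pow_closed)
  then have "-v \<le> u" using int_pow_mono_iff c1 by simp
  \<comment> \<open>The search for the integer part starts at -v, where the power is below g by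
    \<open>lo\<close>, and succeeds at u at the latest. The least hit is not 0, so its predecessor
    gives the lower bound.\<close>
  define k where "k = (LEAST k::nat. lt g (c [^] (-v + int k)))"
  have ex: "lt g (c [^] (-v + int (nat (u + v))))"
    using \<open>-v \<le> u\<close> u by simp
  have k: "lt g (c [^] (-v + int k))"
    unfolding k_def by (rule LeastI, rule ex)
  have "k \<noteq> 0"
    using k lo lt_trans lt_irrefl g c1
    by (metis add.right_neutral int_pow_closed of_nat_0)
  then have "k - 1 < k" by simp
  then have "\<not> lt g (c [^] (-v + int (k - 1)))"
    using not_less_Least k_def by blast
  then have "le (c [^] (-v + int (k - 1))) g"
    using not_le g c1 by blast
  moreover have "-v + int (k - 1) + 1 = -v + int k"
    using \<open>k \<noteq> 0\<close> by simp
  ultimately show ?thesis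
    using k that[of "-v + int (k - 1)"] by metis
qed

text \<open>An error bound that is uniform in the multiplier k disappears after division by k.
  Additivity, uniqueness and vanishing on \<open>C\<close> are all obtained in this way from
  estimates on k-th powers.\<close>

lemma eq_if_multiples_close:
  fixes x y B :: real
  assumes "\<And>k::nat. k > 0 \<Longrightarrow> \<bar>real k * x - real k * y\<bar> \<le> B"
  shows "x = y"
proof (rule ccontr)
  assume "x \<noteq> y"
  then obtain k :: nat where k: "B < real k * \<bar>x - y\<bar>"
    using ex_less_of_nat_mult[of "\<bar>x - y\<bar>" B] by auto
  moreover have "k > 0"
    using assms[of 1] k by (cases k) auto
  ultimately show False
    using assms[of k] by (simp add: abs_mult flip: right_diff_distrib)
qed

text \<open>The number r is the cut between the fractions n/k with c^n below g^k and those with c^n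
  above g^k. Stated as inequalities, it reduces later estimates to comparisons of powers, without
  reference to a supremum.\<close>

definition slope :: "'a \<Rightarrow> 'a \<Rightarrow> real \<Rightarrow> bool" where
  "slope c g r \<longleftrightarrow> (\<forall>k>0. \<forall>n::int.
     (le (c [^] n) (g [^] (k::nat)) \<longrightarrow> of_int n \<le> real k * r) \<and>
     (le (g [^] k) (c [^] n) \<longrightarrow> real k * r \<le> of_int n))"

lemma slope_exists:
  assumes c: "archimedean c" and g: "g \<in> carrier H"
  shows "\<exists>r. slope c g r"
proof -
  have c1: "c \<in> carrier H" "lt \<one> c" using c by (auto simp: archimedean_def)
  define A where "A = {of_int n / real k | n k. k > 0 \<and> le (c [^] (n::int)) (g [^] (k::nat))}"
  \<comment> \<open>Both fractions are compared after raising to the common exponent kl: c^(nl)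
    \<le> g^(kl) \<le> c^(mk).\<close>
  have key: "of_int n / real k \<le> of_int m / real l"
    if "k > 0" "l > 0" "le (c [^] n) (g [^] k)" "le (g [^] l) (c [^] m)"
    for n m :: int and k l :: nat
  proof -
    have "le ((c [^] n) [^] l) ((g [^] k) [^] l)" "le ((g [^] l) [^] k) ((c [^] m) [^] k)"
      using that c1 g by (auto intro!: le_pow)
    moreover have "(g [^] k) [^] l = (g [^] l) [^] k"
      using g by (simp add: nat_pow_pow mult.commute)
    ultimately have "le ((c [^] n) [^] l) ((c [^] m) [^] k)"
      using c1 g le_trans by (metis int_pow_closed nat_pow_closed)
    then have "le (c [^] (n * int l)) (c [^] (m * int k))"
      using c1 by (simp add: int_pow_pow flip: int_pow_int)
    then have "n * int l \<le> m * int k"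
      using int_pow_mono_iff c1 by blast
    then have "real_of_int n * real l \<le> real_of_int m * real k"
      by (metis of_int_le_iff of_int_mult of_int_of_nat_eq)
    then show ?thesis
      using that by (simp add: divide_simps mult.commute)
  qed
  have nonempty: "A \<noteq> {}"
  proof -
    obtain n :: int where "le (c [^] n) (g [^] (1::nat))"
      using archimedean_floor[OF c, of "g [^] (1::nat)"] g by auto
    then have "of_int n / real (1::nat) \<in> A"
      unfolding A_def using zero_less_one by blast
    then show ?thesis by blast
  qed
  obtain m :: int where "lt (g [^] (1::nat)) (c [^] m)"
    using c g by (metis archimedean_def nat_pow_closed)
  then have bdd: "bdd_above A"
    unfolding A_def using key[of _ 1 _ m] by (intro bdd_aboveI[of _ "of_int m"]) (auto simp: le_def)
  have "slope c g (Sup A)"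
    unfolding slope_def
  proof (intro allI impI conjI)
    fix k :: nat and n :: int assume "0 < k"
    { assume "le (c [^] n) (g [^] k)"
      then have "of_int n / real k \<le> Sup A"
        using \<open>0 < k\<close> bdd by (intro cSup_upper) (auto simp: A_def)
      then show "of_int n \<le> real k * Sup A"
        using \<open>0 < k\<close> by (simp add: divide_simps mult.commute) }
    { assume "le (g [^] k) (c [^] n)"
      then have "Sup A \<le> of_int n / real k"
        using \<open>0 < k\<close> key nonempty by (intro cSup_least) (auto simp: A_def)
      then show "real k * Sup A \<le> of_int n"
        using \<open>0 < k\<close> by (simp add: divide_simps mult.commute) }
  qed
  then show ?thesis by blast
qed

definition additive :: "('a \<Rightarrow> real) \<Rightarrow> bool" where
  "additive s \<longleftrightarrow> (\<forall>g\<in>carrier H. \<forall>h\<in>carrier H. s (g \<otimes> h) = s g + s h)"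

definition order_hom :: "('a \<Rightarrow> real) \<Rightarrow> bool" where
  "order_hom s \<longleftrightarrow> additive s \<and> (\<forall>g\<in>carrier H. \<forall>h\<in>carrier H. lt g h \<longrightarrow> s g \<le> s h)"

lemma additive_one: "additive s \<Longrightarrow> s \<one> = 0"
  unfolding additive_def by (metis add_cancel_right_right one_closed r_one)

lemma additive_inv:
  assumes "additive s" "g \<in> carrier H" shows "s (inv g) = - s g"
proof -
  have "s (g \<otimes> inv g) = s g + s (inv g)"
    using assms unfolding additive_def by (meson inv_closed)
  then show ?thesis
    using assms additive_one[OF assms(1)] by simp
qed

lemma additive_nat_pow:
  assumes "additive s" "g \<in> carrier H" shows "s (g [^] (k::nat)) = real k * s g"
  using assms
  by (induction k) (auto simp: additive_one additive_def algebra_simps)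

lemma additive_int_pow:
  assumes "additive s" "g \<in> carrier H" shows "s (g [^] (k::int)) = of_int k * s g"
proof (cases k rule: int_cases2)
  case (nonneg n)
  then show ?thesis using assms by (simp add: additive_nat_pow int_pow_int)
next
  case (nonpos n)
  then show ?thesis using assms by (simp add: additive_nat_pow additive_inv int_pow_neg int_pow_int)
qed

lemma order_hom_le:
  "\<lbrakk>order_hom s; le g h; g \<in> carrier H; h \<in> carrier H\<rbrakk> \<Longrightarrow> s g \<le> s h"
  by (auto simp: order_hom_def le_def)

text \<open>If a and b are the integer parts of g^k and h^k with respect to c, then (gh)^k and
  (hg)^k both lie between c^(a+b) and c^(a+b+2) by \<open>pow_mult_between\<close>, so additivity
  fails by at most 2/k for every k. The two products are treated together, with the factors named so
  that gh \<le> hg.\<close>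

theorem hoelder:
  assumes c: "archimedean c"
  obtains s where "order_hom s" "s c = 1"
proof -
  have c1: "c \<in> carrier H" "lt \<one> c" using c by (auto simp: archimedean_def)
  define s where "s g = (SOME r. slope c g r)" for g
  have s: "slope c g (s g)" if "g \<in> carrier H" for g
    unfolding s_def using slope_exists[OF c that] by (rule someI_ex)
  have lo: "of_int n \<le> real k * s g" if "g \<in> carrier H" "k > 0" "le (c [^] n) (g [^] k)" for g n k
    using s that unfolding slope_def by blast
  have hi: "real k * s g \<le> of_int n" if "g \<in> carrier H" "k > 0" "le (g [^] k) (c [^] n)" for g n k
    using s that unfolding slope_def by blast
  have add': "s (g \<otimes> h) = s g + s h" "s (h \<otimes> g) = s g + s h"
    if gh: "g \<in> carrier H" "h \<in> carrier H" and le: "le (g \<otimes> h) (h \<otimes> g)" for g h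
  proof -
    have *: "\<bar>real k * s (g \<otimes> h) - real k * (s g + s h)\<bar> \<le> 2"
            "\<bar>real k * s (h \<otimes> g) - real k * (s g + s h)\<bar> \<le> 2" if "k > 0" for k :: nat
    proof -
      obtain a :: int where a: "le (c [^] a) (g [^] k)" "lt (g [^] k) (c [^] (a + 1))"
        using archimedean_floor[OF c, of "g [^] k"] gh by auto
      obtain b :: int where b: "le (c [^] b) (h [^] k)" "lt (h [^] k) (c [^] (b + 1))"
        using archimedean_floor[OF c, of "h [^] k"] gh by auto
      have low: "le (c [^] (a + b)) (g [^] k \<otimes> h [^] k)"
        using le_mult[OF a(1) b(1)] gh c1 by (simp add: int_pow_mult)
      have "le (h [^] k \<otimes> g [^] k) (c [^] (b + 1) \<otimes> c [^] (a + 1))"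
        using a b gh c1 by (intro le_mult lt_imp_le) auto
      then have up: "le (h [^] k \<otimes> g [^] k) (c [^] (a + b + 2))"
        using c1 by (simp flip: int_pow_mult add: algebra_simps)
      note between = pow_mult_between[OF le gh, of k]
      have mono: "le ((g \<otimes> h) [^] k) ((h \<otimes> g) [^] k)"
        using le gh by (intro le_pow) auto
      have "of_int a \<le> real k * s g" "real k * s g \<le> of_int (a + 1)"
           "of_int b \<le> real k * s h" "real k * s h \<le> of_int (b + 1)"
        using lo[OF gh(1) \<open>k > 0\<close> a(1)] hi[OF gh(1) \<open>k > 0\<close> lt_imp_le[OF a(2)]]
          lo[OF gh(2) \<open>k > 0\<close> b(1)] hi[OF gh(2) \<open>k > 0\<close> lt_imp_le[OF b(2)]] by blast+
      moreover have "of_int (a + b) \<le> real k * s x \<and> real k * s x \<le> of_int (a + b + 2)"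
        if x: "x \<in> {g \<otimes> h, h \<otimes> g}" for x
      proof -
        have xc: "x \<in> carrier H" using x gh by auto
        have "le (g [^] k \<otimes> h [^] k) (x [^] k)"
          using x between(1) mono gh le_trans[OF between(1) mono] by auto
        then have l: "le (c [^] (a + b)) (x [^] k)"
          by (rule le_trans[OF low]) (use gh c1 xc in auto)
        have "le (x [^] k) (h [^] k \<otimes> g [^] k)"
          using x between(2) mono gh le_trans[OF mono between(2)] by auto
        then have u: "le (x [^] k) (c [^] (a + b + 2))"
          by (rule le_trans[OF _ up]) (use gh c1 xc in auto)
        show ?thesis
          using lo[OF xc \<open>k > 0\<close> l] hi[OF xc \<open>k > 0\<close> u] by blast
      qed
      ultimately show "\<bar>real k * s (g \<otimes> h) - real k * (s g + s h)\<bar> \<le> 2"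
        "\<bar>real k * s (h \<otimes> g) - real k * (s g + s h)\<bar> \<le> 2"
        by (fastforce simp: algebra_simps abs_le_iff)+
    qed
    show "s (g \<otimes> h) = s g + s h" "s (h \<otimes> g) = s g + s h"
      using eq_if_multiples_close *  by blast+
  qed
  have add: "additive s"
    unfolding additive_def using add' le_total by (metis add.commute m_closed)
  have nonneg: "0 \<le> s g" if "g \<in> carrier H" "lt \<one> g" for g
    using lo[of g 1 0] that by (simp add: le_def)
  have "s g \<le> s h" if "g \<in> carrier H" "h \<in> carrier H" "lt g h" for g h
  proof -
    have "0 \<le> s (inv g \<otimes> h)"
      using lt_mult_left[OF \<open>lt g h\<close>, of "inv g"] that by (intro nonneg) auto
    moreover have "s (inv g \<otimes> h) = s (inv g) + s h"
      using add that unfolding additive_def by (meson inv_closed)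
    ultimately show ?thesis
      using that by (simp add: additive_inv[OF add])
  qed
  then have "order_hom s"
    using add by (simp add: order_hom_def)
  moreover have "s c = 1"
    using lo[of c 1 1] hi[of c 1 1] c1 by simp
  ultimately show ?thesis
    using that by blast
qed

text \<open>For each k the integer part n of u^k traps k s(u) in [n, n+1] and k r(u) in
  [n r(c), (n+1) r(c)], so the two sides differ by at most r(c)/k. The factor r(c) may be 0, in
  which case r vanishes identically.\<close>

lemma order_hom_unique:
  assumes c: "archimedean c" and s: "order_hom s" "s c = 1" and r: "order_hom r"
    and u: "u \<in> carrier H"
  shows "r u = r c * s u"
proof (rule eq_if_multiples_close)
  fix k :: nat assume "k > 0"
  have c1: "c \<in> carrier H" using c by (auto simp: archimedean_def)
  obtain n :: int where n: "le (c [^] n) (u [^] k)" "le (u [^] k) (c [^] (n + 1))"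
    using archimedean_floor[OF c, of "u [^] k"] u lt_imp_le by (metis nat_pow_closed)
  have *: "of_int n * f c \<le> real k * f u \<and> real k * f u \<le> of_int (n + 1) * f c"
    if "order_hom f" for f
  proof -
    have "additive f" using that by (simp add: order_hom_def)
    then show ?thesis
      using order_hom_le[OF that n(1)] order_hom_le[OF that n(2)] u c1
      by (simp add: additive_nat_pow additive_int_pow)
  qed
  have "\<one> \<in> carrier H" "lt \<one> c" "additive r" using c r by (auto simp: archimedean_def order_hom_def)
  then have rc: "0 \<le> r c"
    using r c1 additive_one by (metis order_hom_def)
  have "of_int n * r c \<le> real k * s u * r c" "real k * s u * r c \<le> of_int (n + 1) * r c"
    using *[OF s(1)] s(2) rc by (simp_all add: mult_right_mono)
  with *[OF r] show "\<bar>real k * r u - real k * (r c * s u)\<bar> \<le> r c"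
    by (simp add: abs_le_iff algebra_simps)
qed

text \<open>The elements bounded in both directions by powers of d form a convex subgroup
  \<open>D\<close> that contains \<open>C\<close> and d. Since d is outside \<open>C\<close>,
  maximality leaves only the whole group for \<open>D\<close>.\<close>

lemma maximal_convex_archimedean:
  assumes C: "maximal_convex_subgroup H lt C" and d: "d \<in> carrier H" "d \<notin> C" "lt \<one> d"
  shows "archimedean d"
proof -
  have conv: "convex_subgroup H lt C"
    using C by (simp add: maximal_convex_subgroup_def)
  then have subC: "subgroup C H"
    by (simp add: convex_subgroup_def)
  have convC: "g \<in> C" if "a \<in> C" "b \<in> C" "g \<in> carrier H" "lt a g" "lt g b" for a b g
    using conv that unfolding convex_subgroup_def by blast
  \<comment> \<open>Otherwise d would equal g or lie between \<one> and g, and convexity would put d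
    into \<open>C\<close>.\<close>
  have below: "lt g d" if "g \<in> C" for g
    using convC[of \<one> g d] subgroup.one_closed[OF subC] d that lt_total[of g d]
      subgroup.mem_carrier[OF subC] by blast
  define D where "D = {g \<in> carrier H. \<exists>n::int. lt g (d [^] n) \<and> lt (inv g) (d [^] n)}"
  have mono: "lt g (d [^] (n::int)) \<Longrightarrow> n \<le> m \<Longrightarrow> g \<in> carrier H \<Longrightarrow> lt g (d [^] m)" for g n m
    using lt_le_trans int_pow_mono_iff[OF d(1,3)] d by (meson int_pow_closed)
  have "subgroup D H"
  proof (rule subgroup.intro)
    fix g h assume "g \<in> D" "h \<in> D"
    then obtain n m :: int where gh: "g \<in> carrier H" "h \<in> carrier H" "lt g (d [^] n)"
        "lt (inv g) (d [^] n)" "lt h (d [^] m)" "lt (inv h) (d [^] m)"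
      by (auto simp: D_def)
    have "lt (g \<otimes> h) (d [^] (n + m))"
      using lt_mult[OF gh(3,5)] gh d by (simp add: int_pow_mult)
    moreover have "lt (inv (g \<otimes> h)) (d [^] (n + m))"
      using lt_mult[OF gh(6,4)] gh d by (simp add: int_pow_mult inv_mult_group add.commute)
    ultimately show "g \<otimes> h \<in> D"
      using gh by (auto simp: D_def)
  next
    show "\<one> \<in> D"
      using d by (auto simp: D_def intro!: exI[of _ 1])
  qed (auto simp: D_def)
  moreover have "g \<in> D" if ab: "a \<in> D" "b \<in> D" and g: "g \<in> carrier H" "lt a g" "lt g b" for a b g
  proof -
    obtain n m :: int where nm: "lt (inv a) (d [^] n)" "lt b (d [^] m)" and ab': "a \<in> carrier H" "b \<in> carrier H"
      using ab by (auto simp: D_def)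
    have "lt g (d [^] m)" "lt (inv g) (d [^] n)"
      using nm ab' g lt_inv[OF g(2)] d lt_trans by (meson int_pow_closed inv_closed)+
    then show ?thesis
      using g mono[of g m "max m n"] mono[of "inv g" n "max m n"] by (auto simp: D_def)
  qed
  ultimately have "convex_subgroup H lt D"
    unfolding convex_subgroup_def by blast
  moreover have "C \<subseteq> D"
    using below subgroup.mem_carrier[OF subC] subgroup.m_inv_closed[OF subC] d
    by (auto simp: D_def intro!: exI[of _ 1])
  moreover have "d \<in> D"
  proof -
    \<comment> \<open>The bounds in \<open>D\<close> are strict, so d itself needs the exponent
      2.\<close>
    have "lt (d [^] (1::int)) (d [^] (2::int))" "lt (d [^] (-1::int)) (d [^] (2::int))"
      using int_pow_strict_mono[OF d(1,3)] by auto
    then show ?thesis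
      using d by (auto simp: D_def int_pow_neg intro!: exI[of _ 2])
  qed
  ultimately have "D = carrier H"
    using C d by (auto simp: maximal_convex_subgroup_def)
  then show ?thesis
    using d by (auto simp: archimedean_def D_def)
qed

text \<open>On \<open>C\<close> all powers of an element and of its inverse stay below d, so their
  s-values are at most 1 and s vanishes. Conversely, for g outside \<open>C\<close>, either g or its
  inverse is an archimedean e. By uniqueness s is s(e) times the homomorphism normalised at e, and
  s(d) = 1 excludes s(e) = 0.\<close>

theorem maximal_convex_kernel:
  assumes C: "maximal_convex_subgroup H lt C"
  obtains d s where "archimedean d" "order_hom s" "s d = 1" "C = {g \<in> carrier H. s g = 0}"
proof -
  have conv: "convex_subgroup H lt C"
    using C by (simp add: maximal_convex_subgroup_def)
  then have subC: "subgroup C H"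
    by (simp add: convex_subgroup_def)
  have convC: "g \<in> C" if "a \<in> C" "b \<in> C" "g \<in> carrier H" "lt a g" "lt g b" for a b g
    using conv that unfolding convex_subgroup_def by blast
  have pos: "\<exists>d. d \<in> {g, inv g} \<and> archimedean d" if "g \<in> carrier H" "g \<notin> C" for g
  proof (cases "lt \<one> g")
    case True
    then show ?thesis using maximal_convex_archimedean[OF C] that by blast
  next
    case False
    moreover have "g \<noteq> \<one>" using that subgroup.one_closed[OF subC] by blast
    ultimately have "lt g \<one>" using lt_total that by blast
    then have "lt \<one> (inv g)" using lt_inv[of g \<one>] that by simp
    moreover have "inv g \<notin> C"
      using that subgroup.m_inv_closed[OF subC, of "inv g"] by auto
    ultimately show ?thesis using maximal_convex_archimedean[OF C, of "inv g"] that by blast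
  qed
  obtain e where "e \<in> carrier H" "e \<notin> C"
    using C subgroup.subset[OF subC] by (auto simp: maximal_convex_subgroup_def)
  then obtain d where d: "archimedean d" "d \<notin> C"
    using pos[of e] subgroup.m_inv_closed[OF subC, of "inv e"] by force
  then have d1: "d \<in> carrier H" "lt \<one> d" by (auto simp: archimedean_def)
  obtain s where s: "order_hom s" "s d = 1"
    using hoelder[OF d(1)] by blast
  then have add: "additive s" by (simp add: order_hom_def)
  have "s g = 0" if "g \<in> C" for g
  proof -
    have gc: "g \<in> carrier H" using that subgroup.mem_carrier[OF subC] by blast
    have bound: "s x \<le> 1" if "x \<in> C" for x
      using convC[of \<one> x d] subgroup.one_closed[OF subC] d d1 that lt_total[of x d]
        subgroup.mem_carrier[OF subC that] s by (metis order_hom_def)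
    have powC: "g [^] (k::nat) \<in> C" for k
      using that by (induction k) (auto intro: subgroup.one_closed[OF subC] subgroup.m_closed[OF subC])
    have "\<bar>real k * s g - real k * 0\<bar> \<le> 1" for k
      using bound[OF powC[of k]] bound[OF subgroup.m_inv_closed[OF subC powC[of k]]] gc
      by (simp add: additive_inv[OF add] additive_nat_pow[OF add] abs_le_iff)
    then show ?thesis by (rule eq_if_multiples_close)
  qed
  moreover have "g \<in> C" if "g \<in> carrier H" "s g = 0" for g
  proof (rule ccontr)
    assume "g \<notin> C"
    then obtain e where e: "e \<in> {g, inv g}" "archimedean e" using pos \<open>g \<in> carrier H\<close> by blast
    then have "s e = 0" using that additive_inv[OF add] by auto
    obtain r where r: "order_hom r" "r e = 1"
      using hoelder[OF e(2)] by blast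
    show False
      using order_hom_unique[OF e(2) r s(1) d1(1)] \<open>s e = 0\<close> s(2) by simp
  qed
  ultimately have "C = {g \<in> carrier H. s g = 0}"
    using subgroup.mem_carrier[OF subC] by blast
  then show ?thesis
    using that d s by blast
qed

end

section \<open>Convex subgroups and the lower central series\<close>

context group
begin

lemma inv_mult_cancel:
  assumes "x \<in> carrier G" "y \<in> carrier G"
  shows "inv x \<otimes> (x \<otimes> y) = y" "x \<otimes> (inv x \<otimes> y) = y"
  using assms by (simp_all flip: m_assoc)

text \<open>As rewrite rules these nest words to the right, push inverses onto the letters and
  cancel neighbouring inverse pairs, which proves the commutator identities used below.\<close>

lemmas word_simps = m_assoc inv_mult_group inv_mult_cancel

text \<open>Only the inclusion of s K s^-1 in K is required. That conjugation maps K onto itself is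
  expressed by assuming the property for both s and its inverse.\<close>

definition normalizes :: "'a \<Rightarrow> 'a set \<Rightarrow> bool" where
  "normalizes s K \<longleftrightarrow> s \<in> carrier G \<and> (\<forall>u\<in>K. s \<otimes> u \<otimes> inv s \<in> K)"

lemma subgroup_normalizes: "subgroup K G \<Longrightarrow> s \<in> K \<Longrightarrow> normalizes s K"
  unfolding normalizes_def by (meson subgroup.m_closed subgroup.m_inv_closed subgroup.mem_carrier)

lemma subgroup_conj_preimage:
  assumes "subgroup N G" "s \<in> carrier G"
  shows "subgroup {u \<in> carrier G. s \<otimes> u \<otimes> inv s \<in> N} G"
proof (rule subgroupI)
  fix a b
  assume ab: "a \<in> {u \<in> carrier G. s \<otimes> u \<otimes> inv s \<in> N}" "b \<in> {u \<in> carrier G. s \<otimes> u \<otimes> inv s \<in> N}"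
  have "s \<otimes> (a \<otimes> b) \<otimes> inv s = (s \<otimes> a \<otimes> inv s) \<otimes> (s \<otimes> b \<otimes> inv s)"
    using ab assms by (simp add: word_simps)
  then show "a \<otimes> b \<in> {u \<in> carrier G. s \<otimes> u \<otimes> inv s \<in> N}"
    using ab subgroup.m_closed[OF assms(1)] by simp
next
  fix a assume a: "a \<in> {u \<in> carrier G. s \<otimes> u \<otimes> inv s \<in> N}"
  have "s \<otimes> inv a \<otimes> inv s = inv (s \<otimes> a \<otimes> inv s)"
    using a assms by (simp add: word_simps)
  then show "inv a \<in> {u \<in> carrier G. s \<otimes> u \<otimes> inv s \<in> N}"
    using a subgroup.m_inv_closed[OF assms(1)] by simp
next
  have "\<one> \<in> {u \<in> carrier G. s \<otimes> u \<otimes> inv s \<in> N}"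
    using assms subgroup.one_closed by auto
  then show "{u \<in> carrier G. s \<otimes> u \<otimes> inv s \<in> N} \<noteq> {}" by blast
qed auto

text \<open>The elements whose conjugates by s land in \<open>generate G X\<close> form a subgroup,
  so it suffices to test the generators.\<close>

lemma normalizes_generate:
  assumes "X \<subseteq> carrier G" "s \<in> carrier G" "\<And>x. x \<in> X \<Longrightarrow> s \<otimes> x \<otimes> inv s \<in> generate G X"
  shows "normalizes s (generate G X)"
proof -
  have "generate G X \<subseteq> {u \<in> carrier G. s \<otimes> u \<otimes> inv s \<in> generate G X}"
    using assms by (intro generate_subgroup_incl subgroup_conj_preimage generate_is_subgroup) auto
  then show ?thesis
    using assms by (auto simp: normalizes_def)
qed

abbreviation comm :: "'a \<Rightarrow> 'a \<Rightarrow> 'a" where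
  "comm k l \<equiv> k \<otimes> l \<otimes> inv k \<otimes> inv l"

lemma commutator_subgroup_is_subgroup:
  assumes "K \<subseteq> carrier G" "L \<subseteq> carrier G"
  shows "subgroup (commutator_subgroup G K L) G"
  unfolding commutator_subgroup_def using assms
  by (intro generate_is_subgroup) (auto simp: subset_iff)

lemma comm_in: "k \<in> K \<Longrightarrow> l \<in> L \<Longrightarrow> comm k l \<in> commutator_subgroup G K L"
  unfolding commutator_subgroup_def by (rule generate.incl) blast

lemma commutator_subgroup_least:
  assumes "subgroup N G" "\<And>k l. k \<in> K \<Longrightarrow> l \<in> L \<Longrightarrow> comm k l \<in> N"
  shows "commutator_subgroup G K L \<subseteq> N"
  unfolding commutator_subgroup_def using assms by (intro generate_subgroup_incl) auto

lemma normalizes_commutator_subgroup: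
  assumes "K \<subseteq> carrier G" "L \<subseteq> carrier G" "normalizes s K" "normalizes s L"
  shows "normalizes s (commutator_subgroup G K L)"
  unfolding commutator_subgroup_def
proof (rule normalizes_generate)
  fix x assume "x \<in> {comm k l |k l. k \<in> K \<and> l \<in> L}"
  then obtain k l where kl: "x = comm k l" "k \<in> K" "l \<in> L" by blast
  then have "s \<otimes> x \<otimes> inv s = comm (s \<otimes> k \<otimes> inv s) (s \<otimes> l \<otimes> inv s)"
    using assms by (auto simp: normalizes_def word_simps subset_iff)
  moreover have "s \<otimes> k \<otimes> inv s \<in> K" "s \<otimes> l \<otimes> inv s \<in> L"
    using assms kl unfolding normalizes_def by auto
  ultimately show "s \<otimes> x \<otimes> inv s \<in> generate G {comm k l |k l. k \<in> K \<and> l \<in> L}"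
    by (intro generate.incl) blast
qed (use assms in \<open>auto simp: normalizes_def subset_iff\<close>)

text \<open>Modulo \<open>N\<close> the generators a and b commute, hence so do all elements
  generated by them. Membership of commutators in \<open>N\<close> expresses this without forming a
  quotient.\<close>

lemma two_generated_abelian_quotient:
  assumes ab: "a \<in> carrier G" "b \<in> carrier G" and N: "subgroup N G"
    and norm: "\<And>g. g \<in> generate G {a, b} \<Longrightarrow> normalizes g N"
    and c: "comm a b \<in> N"
    and xy: "x \<in> generate G {a, b}" "y \<in> generate G {a, b}"
  shows "comm x y \<in> N"
proof -
  let ?K = "generate G {a, b}"
  have K: "subgroup ?K G" using ab by (intro generate_is_subgroup) auto
  have Kc: "u \<in> carrier G" if "u \<in> ?K" for u
    using subgroup.mem_carrier[OF K that] .
  have Nc: "u \<in> carrier G" if "u \<in> N" for u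
    using subgroup.mem_carrier[OF N that] .
  have conj: "g \<otimes> u \<otimes> inv g \<in> N" if "g \<in> ?K" "u \<in> N" for g u
    using norm that by (auto simp: normalizes_def)
  have swap: "comm v u \<in> N" if "comm u v \<in> N" "u \<in> ?K" "v \<in> ?K" for u v
  proof -
    have "comm v u = inv (comm u v)"
      using that Kc by (simp add: word_simps)
    then show ?thesis using that subgroup.m_inv_closed[OF N] by simp
  qed
  \<comment> \<open>With u fixed the induction is on v, using [u, v w] = [u, v] v [u, w] v^-1 and
    the fact that conjugates by \<open>?K\<close> stay in \<open>N\<close>. It is applied first with
    a generator in the place of u and then with y.\<close>
  have sub: "comm u v \<in> N" if u: "u \<in> ?K" and gens: "comm u a \<in> N" "comm u b \<in> N" and v: "v \<in> ?K" for u v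
    using v
  proof (induction rule: generate.induct)
    case one
    then show ?case using Kc[OF u] subgroup.one_closed[OF N] by simp
  next
    case (incl h)
    then show ?case using gens by auto
  next
    case (inv h)
    then have h: "h \<in> ?K" by (simp add: generate.incl)
    have "comm u (inv h) = inv h \<otimes> inv (comm u h) \<otimes> inv (inv h)"
      using Kc u h by (simp add: word_simps)
    moreover have "inv (comm u h) \<in> N"
      using inv gens subgroup.m_inv_closed[OF N] by auto
    ultimately show ?case
      using conj[of "inv h"] h subgroup.m_inv_closed[OF K] by simp
  next
    case (eng h1 h2)
    then have "comm u (h1 \<otimes> h2) = comm u h1 \<otimes> (h1 \<otimes> comm u h2 \<otimes> inv h1)"
      using Kc u by (simp add: word_simps)
    then show ?case
      using eng conj subgroup.m_closed[OF N] by simp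
  qed
  have abK: "a \<in> ?K" "b \<in> ?K" by (auto intro: generate.incl)
  have triv: "comm u u \<in> N" if "u \<in> ?K" for u
    using Kc[OF that] subgroup.one_closed[OF N] by (simp add: word_simps)
  have "comm a y \<in> N" "comm b y \<in> N"
    using sub[OF abK(1) triv[OF abK(1)] c xy(2)] sub[OF abK(2) swap[OF c abK] triv[OF abK(2)] xy(2)] by auto
  then show ?thesis
    using sub[OF xy(2) _ _ xy(1)] swap abK xy by blast
qed

text \<open>Modulo \<open>[[K,K],K]\<close> the subgroup \<open>[K,K]\<close> is central in \<open>K\<close>, so that \<open>[a,b]\<close> generates it.\<close>

lemma two_generated_commutator_subgroup:
  assumes ab: "a \<in> carrier G" "b \<in> carrier G" and K: "K = generate G {a, b}"
    and K2: "K2 = commutator_subgroup G K K" and K3: "K3 = commutator_subgroup G K2 K"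
    and x: "x \<in> K2"
  obtains k :: int and u where "u \<in> K3" "x = comm a b [^] k \<otimes> u"
proof -
  let ?c = "comm a b"
  \<comment> \<open>This set is shown to be a subgroup normalised by \<open>K\<close>. As it
    contains [a,b], \<open>two_generated_abelian_quotient\<close> puts every commutator of elements
    of \<open>K\<close> into it.\<close>
  define N where "N = {?c [^] k \<otimes> u | (k::int) u. u \<in> K3}"
  have sK: "subgroup K G" using ab unfolding K by (intro generate_is_subgroup) auto
  have Kc: "K \<subseteq> carrier G" using subgroup.subset[OF sK] .
  have sK2: "subgroup K2 G" unfolding K2 using Kc by (intro commutator_subgroup_is_subgroup)
  have K2c: "K2 \<subseteq> carrier G" using subgroup.subset[OF sK2] .
  have sK3: "subgroup K3 G" unfolding K3 using Kc K2c by (intro commutator_subgroup_is_subgroup)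
  have K3c: "K3 \<subseteq> carrier G" using subgroup.subset[OF sK3] .
  have n3: "normalizes g K3" if "g \<in> K" for g
    unfolding K3 using Kc K2c that subgroup_normalizes[OF sK that] unfolding K2
    by (intro normalizes_commutator_subgroup)
  have c2: "?c \<in> K2"
    unfolding K2 K by (intro comm_in) (auto intro: generate.incl)
  have cc: "?c \<in> carrier G" using ab by simp
  have K2K: "K2 \<subseteq> K"
    unfolding K2 using sK
    by (intro commutator_subgroup_least) (auto intro!: subgroup.m_closed[OF sK] subgroup.m_inv_closed[OF sK])
  have pow2: "?c [^] (k::int) \<in> K2" for k
    using subgroup_int_pow_closed[OF sK2 c2] .
  have conj3: "g \<otimes> u \<otimes> inv g \<in> K3" if "g \<in> K" "u \<in> K3" for g u
    using n3[OF that(1)] that(2) by (auto simp: normalizes_def)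
  have NI: "?c [^] (k::int) \<otimes> u \<in> N" if "u \<in> K3" for k u
    using that by (auto simp: N_def)
  have sN: "subgroup N G"
  proof (rule subgroupI)
    show "N \<subseteq> carrier G" using K3c cc by (auto simp: N_def)
    show "N \<noteq> {}" using NI subgroup.one_closed[OF sK3] by blast
  next
    fix g assume "g \<in> N"
    then obtain k :: int and u where g: "g = ?c [^] k \<otimes> u" "u \<in> K3" by (auto simp: N_def)
    then have eq: "inv g = ?c [^] (-k) \<otimes> (?c [^] k \<otimes> inv u \<otimes> inv (?c [^] k))"
      using cc K3c by (auto simp: word_simps int_pow_neg)
    have "?c [^] k \<in> K" using pow2 K2K by blast
    then have "?c [^] k \<otimes> inv u \<otimes> inv (?c [^] k) \<in> K3"
      using subgroup.m_inv_closed[OF sK3 g(2)] by (rule conj3)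
    then show "inv g \<in> N"
      unfolding eq by (rule NI)
  next
    fix g h assume "g \<in> N" "h \<in> N"
    then obtain k l :: int and u v where g: "g = ?c [^] k \<otimes> u" "u \<in> K3"
      and h: "h = ?c [^] l \<otimes> v" "v \<in> K3" by (auto simp: N_def)
    have "inv (?c [^] l) \<in> K" using pow2 K2K subgroup.m_inv_closed[OF sK] by blast
    then have w: "inv (?c [^] l) \<otimes> u \<otimes> inv (inv (?c [^] l)) \<otimes> v \<in> K3"
      using conj3[OF _ g(2)] h(2) subgroup.m_closed[OF sK3] by blast
    have "g \<otimes> h = ?c [^] (k + l) \<otimes> (inv (?c [^] l) \<otimes> u \<otimes> inv (inv (?c [^] l)) \<otimes> v)"
      using g h subsetD[OF K3c g(2)] subsetD[OF K3c h(2)] int_pow_closed[OF cc, of k]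
        int_pow_closed[OF cc, of l] unfolding int_pow_mult[OF cc]
      by (simp add: word_simps del: int_pow_closed)
    then show "g \<otimes> h \<in> N"
      using NI[OF w] by simp
  qed
  have nN: "normalizes g N" if g: "g \<in> K" for g
    unfolding normalizes_def
  proof (intro conjI ballI)
    show "g \<in> carrier G" using g Kc by blast
    fix y assume "y \<in> N"
    then obtain k :: int and u where y: "y = ?c [^] k \<otimes> u" "u \<in> K3" by (auto simp: N_def)
    \<comment> \<open>Moving g past c^k costs the commutator [c^-k, g], which lies in
      \<open>K3\<close> because c^-k is in \<open>K2\<close>.\<close>
    have "comm (?c [^] (-k)) g \<in> K3"
      unfolding K3 using pow2 g by (rule comm_in)
    then have w: "comm (?c [^] (-k)) g \<otimes> (g \<otimes> u \<otimes> inv g) \<in> K3"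
      using conj3[OF g y(2)] subgroup.m_closed[OF sK3] by blast
    have "g \<otimes> y \<otimes> inv g = ?c [^] k \<otimes> (comm (?c [^] (-k)) g \<otimes> (g \<otimes> u \<otimes> inv g))"
      using \<open>g \<in> carrier G\<close> cc y K3c by (auto simp: word_simps int_pow_neg)
    then show "g \<otimes> y \<otimes> inv g \<in> N"
      using NI[OF w] by simp
  qed
  have "?c \<in> N"
    using NI[OF subgroup.one_closed[OF sK3], of 1] cc by simp
  then have "K2 \<subseteq> N"
    unfolding K2 using two_generated_abelian_quotient[OF ab sN] nN sN unfolding K
    by (intro commutator_subgroup_least) auto
  then show ?thesis
    using x that by (auto simp: N_def)
qed

text \<open>The algebraic core. The topology enters through \<open>t\<close>, in the role of the
  stable letter, and through \<open>char\<close>, the triviality of real characters of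
  \<open>K\<close> that conjugation by \<open>t\<close> leaves invariant. Since \<open>f\<close> is
  a function on the whole type, \<open>char\<close> speaks of its values on \<open>K\<close>
  only.\<close>

theorem maximal_convex_eq_third_lower_central:
  assumes order: "bi_ordering G lt"
    and ab: "a \<in> carrier G" "b \<in> carrier G" and K: "K = generate G {a, b}"
    and K2: "K2 = commutator_subgroup G K K" and K3: "K3 = commutator_subgroup G K2 K"
    and t: "normalizes t K" "normalizes (inv t) K"
    and char: "\<And>f :: 'a \<Rightarrow> real. \<lbrakk>\<And>g h. \<lbrakk>g \<in> K; h \<in> K\<rbrakk> \<Longrightarrow> f (g \<otimes> h) = f g + f h;
        \<And>g. g \<in> K \<Longrightarrow> f (t \<otimes> g \<otimes> inv t) = f g\<rbrakk> \<Longrightarrow> \<forall>g\<in>K. f g = 0"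
    and C: "maximal_convex_subgroup (G\<lparr>carrier := K2\<rparr>) (restrict_order lt K2) C"
  shows "C = K3"
proof -
  let ?H = "G\<lparr>carrier := K2\<rparr>" and ?lt = "restrict_order lt K2"
  have sK: "subgroup K G" using ab unfolding K by (intro generate_is_subgroup) auto
  have Kc: "K \<subseteq> carrier G" using subgroup.subset[OF sK] .
  have sK2: "subgroup K2 G" unfolding K2 using Kc by (intro commutator_subgroup_is_subgroup)
  have K2c: "K2 \<subseteq> carrier G" using subgroup.subset[OF sK2] .
  have K2K: "K2 \<subseteq> K"
    unfolding K2 using sK
    by (intro commutator_subgroup_least) (auto intro!: subgroup.m_closed[OF sK] subgroup.m_inv_closed[OF sK])
  have sK3: "subgroup K3 G" unfolding K3 using Kc K2c by (intro commutator_subgroup_is_subgroup)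
  have groupH: "group ?H" using sK2 by (rule subgroup_imp_group)
  interpret B: bi_ordered_group G lt
    using order by unfold_locales
  have orderH: "bi_ordering ?H ?lt"
    unfolding bi_ordering_def
  proof (intro conjI ballI impI)
    show "irreflp_on (carrier ?H) ?lt"
      using B.lt_irrefl K2c by (auto simp: irreflp_on_def restrict_order_def)
    show "transp_on (carrier ?H) ?lt"
      using B.lt_trans K2c by (simp add: transp_on_def restrict_order_def) blast
    show "totalp_on (carrier ?H) ?lt"
      using B.lt_total K2c by (simp add: totalp_on_def restrict_order_def) blast
  next
    fix u v g assume "u \<in> carrier ?H" "v \<in> carrier ?H" "g \<in> carrier ?H" "?lt u v"
    then show "?lt (g \<otimes>\<^bsub>?H\<^esub> u) (g \<otimes>\<^bsub>?H\<^esub> v)" "?lt (u \<otimes>\<^bsub>?H\<^esub> g) (v \<otimes>\<^bsub>?H\<^esub> g)"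
      using B.lt_mult_left B.lt_mult_right K2c subgroup.m_closed[OF sK2]
      by (auto simp: restrict_order_def subset_iff)
  qed
  interpret H: bi_ordered_group ?H ?lt
    using groupH orderH by (simp add: bi_ordered_group_def bi_ordered_group_axioms_def)
  obtain d s where d: "H.archimedean d" and s: "H.order_hom s" "s d = 1"
    and ker: "C = {g \<in> K2. s g = 0}"
    using H.maximal_convex_kernel[OF C] by auto
  have d1: "d \<in> K2" using d by (auto simp: H.archimedean_def)
  have addH: "H.additive s" using s(1) by (simp add: H.order_hom_def)
  have add: "s (g \<otimes> h) = s g + s h" if "g \<in> K2" "h \<in> K2" for g h
    using addH that by (auto simp: H.additive_def)
  \<comment> \<open>The domain on which conjugation acts on \<open>K2\<close> and scaling factors
    multiply; it contains \<open>K\<close>, \<open>t\<close> and the inverse of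
    \<open>t\<close>.\<close>
  define S where "S = {g. normalizes g K2}"
  have SI: "g \<in> S" if "normalizes g K" for g
    unfolding S_def K2 using Kc that by (auto intro: normalizes_commutator_subgroup)
  have KS: "g \<in> S" if "g \<in> K" for g
    using SI subgroup_normalizes[OF sK that] by blast
  define lam where "lam g = s (g \<otimes> d \<otimes> inv g)" for g
  have scale: "s (g \<otimes> u \<otimes> inv g) = lam g * s u" if g: "g \<in> S" and u: "u \<in> K2" for g u
  proof -
    have gc: "g \<in> carrier G" and conj: "\<And>u. u \<in> K2 \<Longrightarrow> g \<otimes> u \<otimes> inv g \<in> K2"
      using g by (auto simp: S_def normalizes_def)
    \<comment> \<open>Conjugation by g preserves product and order, so this is another order
      homomorphism and uniqueness makes it a multiple of s. The factor is its value at d because s d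
      = 1.\<close>
    have "H.order_hom (\<lambda>u. s (g \<otimes> u \<otimes> inv g))"
      unfolding H.order_hom_def H.additive_def
    proof (intro conjI ballI impI)
      fix u v assume uv: "u \<in> carrier ?H" "v \<in> carrier ?H"
      have "g \<otimes> (u \<otimes> v) \<otimes> inv g = (g \<otimes> u \<otimes> inv g) \<otimes> (g \<otimes> v \<otimes> inv g)"
        using uv gc K2c by (auto simp: word_simps subset_iff)
      then show "s (g \<otimes> (u \<otimes>\<^bsub>?H\<^esub> v) \<otimes> inv g) = s (g \<otimes> u \<otimes> inv g) + s (g \<otimes> v \<otimes> inv g)"
        using add conj uv by simp
    next
      fix u v assume uv: "u \<in> carrier ?H" "v \<in> carrier ?H" and "?lt u v"
      then have "lt u v" by (simp add: restrict_order_def)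
      moreover have "u \<in> carrier G" "v \<in> carrier G" using uv K2c by auto
      ultimately have "lt (g \<otimes> u \<otimes> inv g) (g \<otimes> v \<otimes> inv g)"
        using order gc unfolding bi_ordering_def by (meson inv_closed m_closed)
      then have "?lt (g \<otimes> u \<otimes> inv g) (g \<otimes> v \<otimes> inv g)"
        using conj uv by (simp add: restrict_order_def)
      then show "s (g \<otimes> u \<otimes> inv g) \<le> s (g \<otimes> v \<otimes> inv g)"
        using s(1) conj uv by (auto simp: H.order_hom_def)
    qed
    then show ?thesis
      using H.order_hom_unique[OF d s] u by (simp add: lam_def)
  qed
  have lam_mult: "lam (g \<otimes> h) = lam g * lam h" if g: "g \<in> S" and h: "h \<in> S" for g h
  proof -
    have "g \<otimes> h \<otimes> d \<otimes> inv (g \<otimes> h) = g \<otimes> (h \<otimes> d \<otimes> inv h) \<otimes> inv g"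
      using g h d1 K2c by (auto simp: S_def normalizes_def word_simps subset_iff)
    moreover have "h \<otimes> d \<otimes> inv h \<in> K2"
      using h d1 by (auto simp: S_def normalizes_def)
    ultimately show ?thesis
      using scale[OF g] by (simp add: lam_def)
  qed
  have lam_one: "lam \<one> = 1"
    using d1 K2c s(2) by (auto simp: lam_def)
  \<comment> \<open>Preservation of the order only yields \<open>lam g\<close> \<ge> 0; the inverse
    of g in \<open>S\<close> excludes 0.\<close>
  have lam_pos: "lam g > 0" if g: "g \<in> S" "inv g \<in> S" for g
  proof -
    have gc: "g \<in> carrier G" using g by (auto simp: S_def normalizes_def)
    have one: "lam g * lam (inv g) = 1"
      using lam_mult[OF g] gc lam_one by simp
    have "lt \<one> d" using d by (auto simp: H.archimedean_def restrict_order_def)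
    then have "lt (g \<otimes> \<one> \<otimes> inv g) (g \<otimes> d \<otimes> inv g)"
      using order gc d1 K2c unfolding bi_ordering_def by (meson inv_closed m_closed one_closed subsetD)
    then have "lt \<one> (g \<otimes> d \<otimes> inv g)" using gc by simp
    moreover have "g \<otimes> d \<otimes> inv g \<in> K2" "\<one> \<in> K2"
      using g d1 subgroup.one_closed[OF sK2] by (auto simp: S_def normalizes_def)
    ultimately have "s \<one> \<le> lam g"
      using s(1) unfolding lam_def H.order_hom_def by (simp add: restrict_order_def)
    moreover have "s \<one> = 0" using H.additive_one[OF addH] by simp
    ultimately show ?thesis
      using one by (metis mult_zero_left order_le_less zero_neq_one)
  qed
  have tS: "t \<in> S" "inv t \<in> S" using t SI by auto
  have tc: "t \<in> carrier G" using t by (simp add: normalizes_def)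
  have invK: "inv g \<in> S" if "g \<in> K" for g
    using KS subgroup.m_inv_closed[OF sK that] by blast
  have "\<forall>g\<in>K. ln (lam g) = 0"
  proof (rule char)
    fix g h assume gh: "g \<in> K" "h \<in> K"
    then have "lam g > 0" "lam h > 0"
      using lam_pos KS invK by auto
    then show "ln (lam (g \<otimes> h)) = ln (lam g) + ln (lam h)"
      using lam_mult KS gh by (simp add: ln_mult)
  next
    fix g assume g: "g \<in> K"
    have SS: "g \<otimes> h \<in> S" if "g \<in> S" "h \<in> S" for g h
    proof -
      have "g \<otimes> h \<otimes> u \<otimes> inv (g \<otimes> h) = g \<otimes> (h \<otimes> u \<otimes> inv h) \<otimes> inv g" if "u \<in> K2" for u
        using \<open>g \<in> S\<close> \<open>h \<in> S\<close> that K2c by (auto simp: S_def normalizes_def word_simps subset_iff)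
      then show ?thesis
        using that by (auto simp: S_def normalizes_def)
    qed
    \<comment> \<open>Scaling factors are real numbers and commute, so those of t and its inverse
      cancel.\<close>
    have "lam (t \<otimes> g \<otimes> inv t) = lam t * lam g * lam (inv t)"
      using lam_mult tS KS[OF g] SS by simp
    also have "\<dots> = lam g"
      using lam_mult[OF tS] tc lam_one by (simp add: mult.commute mult.left_commute)
    finally show "ln (lam (t \<otimes> g \<otimes> inv t)) = ln (lam g)" by simp
  qed
  then have lam1: "lam g = 1" if "g \<in> K" for g
    using lam_pos[OF KS[OF that] invK[OF that]] that ln_eq_zero_iff by blast
  have "subgroup C ?H"
    using C by (auto simp: maximal_convex_subgroup_def convex_subgroup_def)
  then have sC: "subgroup C G"
    using incl_subgroup[OF sK2] by blast
  \<comment> \<open>A generator [k,l] is k times the conjugate of k^-1 by l. Conjugation by elements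
    of \<open>K\<close> is now known to leave s unchanged, so the two contributions cancel.\<close>
  have "K3 \<subseteq> C"
    unfolding K3
  proof (rule commutator_subgroup_least[OF sC])
    fix k l assume kl: "k \<in> K2" "l \<in> K"
    have ik: "inv k \<in> K2" using subgroup.m_inv_closed[OF sK2 kl(1)] .
    have cl: "l \<otimes> inv k \<otimes> inv l \<in> K2"
      using KS[OF kl(2)] ik by (auto simp: S_def normalizes_def)
    have eq: "comm k l = k \<otimes> (l \<otimes> inv k \<otimes> inv l)"
      using kl Kc K2c by (auto simp: word_simps subset_iff)
    have "s (inv k) = - s k"
      using add[OF kl(1) ik] H.additive_one[OF addH] kl K2c by (auto simp: subset_iff)
    then have "s (comm k l) = 0"
      unfolding eq using add[OF kl(1) cl] scale[OF KS[OF kl(2)] ik] lam1[OF kl(2)] by simp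
    moreover have "comm k l \<in> K2"
      unfolding eq using subgroup.m_closed[OF sK2 kl(1) cl] .
    ultimately show "comm k l \<in> C" by (simp add: ker)
  qed
  let ?c = "comm a b"
  have c2: "?c \<in> K2"
    unfolding K2 K by (intro comm_in) (auto intro: generate.incl)
  have s_eq: "s (?c [^] k \<otimes> u) = of_int k * s ?c" if "u \<in> K3" for k :: int and u
  proof -
    have u: "u \<in> K2" "s u = 0" using that \<open>K3 \<subseteq> C\<close> by (auto simp: ker)
    have "?c [^]\<^bsub>?H\<^esub> k = ?c [^] k"
      using int_pow_consistent[OF sK2 c2] by simp
    then have "s (?c [^] k) = of_int k * s ?c"
      using H.additive_int_pow[OF addH, of ?c k] c2 by simp
    then show ?thesis
      using add[OF subgroup_int_pow_closed[OF sK2 c2] u(1)] u(2) by simp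
  qed
  \<comment> \<open>If s vanished at [a,b], it would vanish at every [a,b]^k u, in particular at d,
    where it equals 1.\<close>
  have sc: "s ?c \<noteq> 0"
  proof
    assume "s ?c = 0"
    then show False
      using two_generated_commutator_subgroup[OF ab K K2 K3 d1] s_eq s(2)
      by (metis mult_zero_right zero_neq_one)
  qed
  have "C \<subseteq> K3"
  proof
    fix x assume x: "x \<in> C"
    then have "x \<in> K2" "s x = 0" by (auto simp: ker)
    then obtain k :: int and u where u: "u \<in> K3" "x = ?c [^] k \<otimes> u"
      using two_generated_commutator_subgroup[OF ab K K2 K3] by metis
    then have "k = 0" using s_eq \<open>s x = 0\<close> sc by simp
    then show "x \<in> K3" using u subgroup.mem_carrier[OF sK3] by simp
  qed
  with \<open>K3 \<subseteq> C\<close> show ?thesis by blast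
qed

end

section \<open>Homotopies of paths in topological spaces\<close>

text \<open>
  In a space without linear structure, homotopies between reparametrised paths are images of
  straight-line homotopies in a convex parameter domain.
\<close>

lemma homotopic_paths_convex_image:
  fixes f :: "'a::real_normed_vector \<Rightarrow> 'b::topological_space"
  assumes "convex S" "continuous_on S f" "f ` S \<subseteq> T"
    and "path p" "path_image p \<subseteq> S" "path r" "path_image r \<subseteq> S"
    and "pathstart r = pathstart p" "pathfinish r = pathfinish p"
  shows "homotopic_paths T (f \<circ> p) (f \<circ> r)"
proof -
  have "closed_segment (p t) (r t) \<subseteq> S" if "t \<in> {0..1}" for t
    using assms that by (intro closed_segment_subset) (auto simp: path_image_def)
  then have "homotopic_paths S p r"
    using assms by (intro homotopic_paths_linear) auto
  then show ?thesis
    using assms by (intro homotopic_paths_continuous_image) auto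
qed

lemma linepath_01: "linepath 0 (1::real) = id"
  by (auto simp: linepath_def)

text \<open>Any two paths in the unit interval with common ends are homotopic, so p may be
  reparametrised freely. The unit and inverse laws below are instances:
  \<open>p +++ reversepath p\<close>, for example, is p after a path that runs from 0 to 1 and
  back.\<close>

lemma homotopic_paths_image_interval:
  assumes p: "path p" "path_image p \<subseteq> T"
    and r: "path r" "path_image r \<subseteq> {0..1}" "path s" "path_image s \<subseteq> {0..1::real}"
      "pathstart s = pathstart r" "pathfinish s = pathfinish r"
  shows "homotopic_paths T (p \<circ> r) (p \<circ> s)"
  using assms by (intro homotopic_paths_convex_image[where S = "{0..1}"])
    (auto simp: path_def path_image_def)

lemma homotopic_paths_const_right:
  assumes "path p" "path_image p \<subseteq> T" "pathfinish p = x"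
  shows "homotopic_paths T (p +++ (\<lambda>_. x)) p"
proof -
  have "p +++ (\<lambda>_. x) = p \<circ> (id +++ (\<lambda>_. 1))"
    using assms by (auto simp: joinpaths_def pathfinish_def fun_eq_iff)
  moreover have "homotopic_paths T (p \<circ> (linepath 0 1 +++ linepath 1 1)) (p \<circ> linepath 0 1)"
    using assms by (intro homotopic_paths_image_interval) (auto simp: path_image_join closed_segment_eq_real_ivl)
  moreover have "linepath 1 1 = (\<lambda>_. 1::real)"
    by (auto simp: linepath_def)
  ultimately show ?thesis
    by (simp add: linepath_01)
qed

lemma homotopic_paths_const_left:
  assumes "path p" "path_image p \<subseteq> T" "pathstart p = x"
  shows "homotopic_paths T ((\<lambda>_. x) +++ p) p"
proof -
  have "(\<lambda>_. x) +++ p = p \<circ> ((\<lambda>_. 0) +++ id)"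
    using assms by (auto simp: joinpaths_def pathstart_def fun_eq_iff)
  moreover have "homotopic_paths T (p \<circ> (linepath 0 0 +++ linepath 0 1)) (p \<circ> linepath 0 1)"
    using assms by (intro homotopic_paths_image_interval) (auto simp: path_image_join closed_segment_eq_real_ivl)
  moreover have "linepath 0 0 = (\<lambda>_. 0::real)"
    by (auto simp: linepath_def)
  ultimately show ?thesis
    by (simp add: linepath_01)
qed

lemma homotopic_paths_reversepath_right:
  assumes "path p" "path_image p \<subseteq> T" "pathstart p = x"
  shows "homotopic_paths T (p +++ reversepath p) (\<lambda>_. x)"
proof -
  have "p +++ reversepath p = p \<circ> (id +++ reversepath id)"
    by (auto simp: joinpaths_def reversepath_def fun_eq_iff)
  moreover have "homotopic_paths T (p \<circ> (linepath 0 1 +++ reversepath (linepath 0 1))) (p \<circ> linepath 0 0)"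
    using assms by (intro homotopic_paths_image_interval) (auto simp: path_image_join closed_segment_eq_real_ivl)
  moreover have "linepath 0 0 = (\<lambda>_. 0::real)"
    by (auto simp: linepath_def)
  ultimately show ?thesis
    using assms by (simp add: linepath_01 comp_def pathstart_def)
qed

lemma homotopic_paths_reversepath_left:
  assumes "path p" "path_image p \<subseteq> T" "pathfinish p = x"
  shows "homotopic_paths T (reversepath p +++ p) (\<lambda>_. x)"
  using homotopic_paths_reversepath_right[of "reversepath p" T x] assms by simp

section \<open>The fundamental group\<close>

definition loop_at :: "'a::topological_space set \<Rightarrow> 'a \<Rightarrow> (real \<Rightarrow> 'a) \<Rightarrow> bool" where
  "loop_at S x p \<longleftrightarrow> path p \<and> path_image p \<subseteq> S \<and> pathstart p = x \<and> pathfinish p = x"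

lemma loop_atD:
  assumes "loop_at S x p"
  shows "path p" "path_image p \<subseteq> S" "pathstart p = x" "pathfinish p = x"
  using assms by (auto simp: loop_at_def)

lemma loop_at_const: "x \<in> S \<Longrightarrow> loop_at S x (\<lambda>_. x)"
  by (auto simp: loop_at_def path_def path_image_def pathstart_def pathfinish_def)

lemma loop_at_join: "loop_at S x p \<Longrightarrow> loop_at S x r \<Longrightarrow> loop_at S x (p +++ r)"
  by (auto simp: loop_at_def path_image_join)

lemma loop_at_reversepath: "loop_at S x p \<Longrightarrow> loop_at S x (reversepath p)"
  by (auto simp: loop_at_def)

lemma loop_at_compose:
  assumes "loop_at S x p" "continuous_on S f" "f ` S \<subseteq> S'"
  shows "loop_at S' (f x) (f \<circ> p)"
  using assms unfolding loop_at_def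
  by (auto simp: pathstart_compose pathfinish_compose path_image_compose
      intro!: path_continuous_image elim: continuous_on_subset)

lemma path_class_eq: "homotopic_paths S p r \<Longrightarrow> path_class S p = path_class S r"
  unfolding path_class_def using homotopic_paths_trans homotopic_paths_sym by blast

lemma path_class_self: "path p \<Longrightarrow> path_image p \<subseteq> S \<Longrightarrow> p \<in> path_class S p"
  by (simp add: path_class_def)

lemma path_class_eq_iff:
  assumes "path r" "path_image r \<subseteq> S"
  shows "path_class S p = path_class S r \<longleftrightarrow> homotopic_paths S p r"
  using path_class_self[OF assms] path_class_eq by (auto simp: path_class_def)

lemma carrier_fundamental_group:
  "carrier (fundamental_group S x) = {path_class S p | p. loop_at S x p}"
  by (simp add: fundamental_group_def loop_at_def)

lemma path_class_in_carrier: "loop_at S x p \<Longrightarrow> path_class S p \<in> carrier (fundamental_group S x)"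
  by (auto simp: carrier_fundamental_group)

lemma mult_fundamental_group:
  assumes "loop_at S x p" "loop_at S x r"
  shows "path_class S p \<otimes>\<^bsub>fundamental_group S x\<^esub> path_class S r = path_class S (p +++ r)"
proof -
  have eq: "path_class S (p +++ r) = path_class S (p' +++ r')"
    if "p' \<in> path_class S p" "r' \<in> path_class S r" for p' r'
    using that assms
    by (intro path_class_eq homotopic_paths_join)
      (auto simp: path_class_def loop_at_def)
  have "p \<in> path_class S p" "r \<in> path_class S r"
    using assms by (auto simp: loop_at_def path_class_self)
  moreover have "(\<Union>p'\<in>path_class S p. \<Union>r'\<in>path_class S r. path_class S (p' +++ r')) =
      (\<Union>p'\<in>path_class S p. \<Union>r'\<in>path_class S r. path_class S (p +++ r))"
    using eq by (intro SUP_cong refl) simp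
  ultimately have "(\<Union>p'\<in>path_class S p. \<Union>r'\<in>path_class S r. path_class S (p' +++ r')) =
      path_class S (p +++ r)"
    by auto
  then show ?thesis
    by (simp add: fundamental_group_def)
qed

lemma one_fundamental_group: "\<one>\<^bsub>fundamental_group S x\<^esub> = path_class S (\<lambda>_. x)"
  by (simp add: fundamental_group_def)

lemma group_fundamental_group:
  assumes x: "x \<in> S"
  shows "group (fundamental_group S x)"
proof (rule groupI)
  let ?G = "fundamental_group S x"
  fix a b c assume "a \<in> carrier ?G" "b \<in> carrier ?G" "c \<in> carrier ?G"
  then obtain p r s where prs: "a = path_class S p" "b = path_class S r" "c = path_class S s"
    and l: "loop_at S x p" "loop_at S x r" "loop_at S x s"
    by (auto simp: carrier_fundamental_group)
  show "a \<otimes>\<^bsub>?G\<^esub> b \<in> carrier ?G"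
    using prs l by (simp add: mult_fundamental_group path_class_in_carrier loop_at_join)
  have "homotopic_paths S (p +++ (r +++ s)) ((p +++ r) +++ s)"
    using l by (intro homotopic_paths_assoc) (auto simp: loop_at_def)
  then show "a \<otimes>\<^bsub>?G\<^esub> b \<otimes>\<^bsub>?G\<^esub> c = a \<otimes>\<^bsub>?G\<^esub> (b \<otimes>\<^bsub>?G\<^esub> c)"
    using prs l path_class_eq[symmetric] by (simp add: mult_fundamental_group loop_at_join)
  show "\<one>\<^bsub>?G\<^esub> \<otimes>\<^bsub>?G\<^esub> a = a"
    using prs l x path_class_eq[OF homotopic_paths_const_left[of p S x]]
    by (simp add: mult_fundamental_group one_fundamental_group loop_at_const loop_atD[OF l(1)])
  have "path_class S (reversepath p) \<otimes>\<^bsub>?G\<^esub> a = \<one>\<^bsub>?G\<^esub>"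
    using prs l path_class_eq[OF homotopic_paths_reversepath_left[of p S x]]
    by (simp add: mult_fundamental_group one_fundamental_group loop_at_reversepath loop_atD[OF l(1)])
  then show "\<exists>y\<in>carrier ?G. y \<otimes>\<^bsub>?G\<^esub> a = \<one>\<^bsub>?G\<^esub>"
    using l path_class_in_carrier loop_at_reversepath by blast
qed (use x in \<open>auto simp: one_fundamental_group path_class_in_carrier loop_at_const\<close>)

lemma inv_fundamental_group:
  assumes l: "loop_at S x p"
  shows "inv\<^bsub>fundamental_group S x\<^esub> path_class S p = path_class S (reversepath p)"
proof -
  have "x \<in> S" using l by (metis loop_at_def pathstart_in_path_image subsetD)
  then interpret group "fundamental_group S x" by (rule group_fundamental_group)
  show ?thesis
  proof (rule inv_equality)
    show "path_class S (reversepath p) \<otimes>\<^bsub>fundamental_group S x\<^esub> path_class S p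
        = \<one>\<^bsub>fundamental_group S x\<^esub>"
      using l path_class_eq[OF homotopic_paths_reversepath_left[of p S x]]
      by (simp add: mult_fundamental_group one_fundamental_group loop_at_reversepath loop_atD[OF l])
  qed (use l loop_at_reversepath path_class_in_carrier in blast)+
qed

lemma fundamental_group_map_class:
  assumes "continuous_on S f" "f ` S \<subseteq> S'" "path p" "path_image p \<subseteq> S"
  shows "fundamental_group_map f S' (path_class S p) = path_class S' (f \<circ> p)"
proof -
  have "path_class S' (f \<circ> p) = path_class S' (f \<circ> p')" if "p' \<in> path_class S p" for p'
    using that assms
    by (intro path_class_eq homotopic_paths_continuous_image[where S = S])
      (auto simp: path_class_def)
  then have "(\<Union>p'\<in>path_class S p. path_class S' (f \<circ> p')) = (\<Union>p'\<in>path_class S p. path_class S' (f \<circ> p))"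
    by (intro SUP_cong) auto
  then show ?thesis
    unfolding fundamental_group_map_def using path_class_self[OF assms(3,4)] by auto
qed

section \<open>Evaluating paths in the fundamental group\<close>

text \<open>Every point gets a chosen path from x, with no continuity in the point. The choices
  extend the class of a loop to a value for arbitrary paths, so that singular edges and pieces of
  loops can be evaluated in the group. The path to x is constant, so that a loop keeps its own
  class.\<close>

locale based_paths =
  fixes S :: "'a::topological_space set" and x :: 'a and base :: "'a \<Rightarrow> real \<Rightarrow> 'a"
  assumes x_in: "x \<in> S" and base_x: "base x = (\<lambda>_. x)"
    and base: "\<And>y. y \<in> S \<Longrightarrow> path (base y)" "\<And>y. y \<in> S \<Longrightarrow> path_image (base y) \<subseteq> S"
      "\<And>y. y \<in> S \<Longrightarrow> pathstart (base y) = x" "\<And>y. y \<in> S \<Longrightarrow> pathfinish (base y) = y"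
begin

definition path_in :: "(real \<Rightarrow> 'a) \<Rightarrow> bool" where
  "path_in p \<longleftrightarrow> path p \<and> path_image p \<subseteq> S"

definition eval :: "(real \<Rightarrow> 'a) \<Rightarrow> (real \<Rightarrow> 'a) set" where
  "eval p = path_class S (base (pathstart p) +++ (p +++ reversepath (base (pathfinish p))))"

sublocale group "fundamental_group S x"
  using x_in by (rule group_fundamental_group)

lemma path_in_ends: "path_in p \<Longrightarrow> pathstart p \<in> S" "path_in p \<Longrightarrow> pathfinish p \<in> S"
  unfolding path_in_def by auto

lemma path_in_join: "path_in p \<Longrightarrow> path_in r \<Longrightarrow> pathfinish p = pathstart r \<Longrightarrow> path_in (p +++ r)"
  by (auto simp: path_in_def path_image_join)

lemma path_in_reversepath [simp]: "path_in (reversepath p) \<longleftrightarrow> path_in p"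
  by (simp add: path_in_def)

lemma path_in_const: "y \<in> S \<Longrightarrow> path_in (\<lambda>_. y)"
  by (auto simp: path_in_def path_def path_image_def)

lemma path_in_base: "y \<in> S \<Longrightarrow> path_in (base y)"
  by (simp add: path_in_def base)

lemma path_in_homotopic: "homotopic_paths S p r \<Longrightarrow> path_in p \<and> path_in r"
  using homotopic_paths_imp_path homotopic_paths_imp_subset path_in_def by blast

lemma loop_at_path_in: "loop_at S x p \<Longrightarrow> path_in p"
  by (simp add: loop_at_def path_in_def)

lemma loop_at_base:
  assumes "path_in p"
  shows "loop_at S x (base (pathstart p) +++ (p +++ reversepath (base (pathfinish p))))"
  using assms path_in_ends[OF assms] base
  by (auto simp: loop_at_def path_in_def path_image_join)

lemma eval_closed [simp]: "path_in p \<Longrightarrow> eval p \<in> carrier (fundamental_group S x)"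
  unfolding eval_def by (intro path_class_in_carrier loop_at_base)

lemma eval_homotopic:
  assumes "homotopic_paths S p r"
  shows "eval p = eval r"
proof -
  have pr: "path_in p" "path_in r" using path_in_homotopic[OF assms] by auto
  have ends: "pathstart r = pathstart p" "pathfinish r = pathfinish p"
    using assms homotopic_paths_imp_pathstart homotopic_paths_imp_pathfinish by metis+
  show ?thesis
    unfolding eval_def ends using base path_in_ends[OF pr(1)] assms ends
    by (intro path_class_eq homotopic_paths_join) auto
qed

lemma class_assoc:
  assumes "path_in p" "path_in r" "path_in s" "pathfinish p = pathstart r" "pathfinish r = pathstart s"
  shows "path_class S ((p +++ r) +++ s) = path_class S (p +++ (r +++ s))"
  using assms path_class_eq[OF homotopic_paths_assoc[of p S r s]] by (simp add: path_in_def)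

lemma class_join_cong:
  assumes "path_class S p = path_class S p'" "path_class S r = path_class S r'"
    and "path_in p'" "path_in r'" "pathfinish p = pathstart r"
  shows "path_class S (p +++ r) = path_class S (p' +++ r')"
proof -
  have "homotopic_paths S p p'" "homotopic_paths S r r'"
    using assms by (simp_all add: path_class_eq_iff path_in_def)
  then show ?thesis
    using assms by (intro path_class_eq homotopic_paths_join)
qed

lemma class_cancel:
  assumes "path_in p" "path_in r" "pathfinish p = pathstart r"
  shows "path_class S (reversepath p +++ (p +++ r)) = path_class S r"
proof -
  have "path_class S (reversepath p +++ (p +++ r)) = path_class S ((reversepath p +++ p) +++ r)"
    using assms by (simp add: class_assoc)
  also have "\<dots> = path_class S ((\<lambda>_. pathfinish p) +++ r)"
    using assms path_class_eq[OF homotopic_paths_reversepath_left[of p S "pathfinish p"]]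
      path_in_const[OF path_in_ends(2)[OF assms(1)]]
    by (intro class_join_cong) (auto simp: path_in_def)
  also have "\<dots> = path_class S r"
    using assms path_class_eq[OF homotopic_paths_const_left[of r S "pathfinish p"]]
    by (simp add: path_in_def)
  finally show ?thesis .
qed

text \<open>At the common end the base path is run backwards and then forwards, and cancels.
  Together with homotopy invariance this makes \<open>eval\<close> a functor from the fundamental
  groupoid to the group.\<close>

lemma eval_join:
  assumes pr: "path_in p" "path_in r" "pathfinish p = pathstart r"
  shows "eval (p +++ r) = eval p \<otimes>\<^bsub>fundamental_group S x\<^esub> eval r"
proof -
  define b0 b1 b2 where "b0 = base (pathstart p)" and "b1 = base (pathfinish p)"
    and "b2 = reversepath (base (pathfinish r))"
  note ends = path_in_ends[OF pr(1)] path_in_ends[OF pr(2)]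
  have b: "path_in b0" "path_in b1" "path_in b2" "pathfinish b0 = pathstart p"
    "pathfinish b1 = pathstart r" "pathstart b2 = pathfinish r" "pathstart b1 = x"
    using base ends path_in_base pr(3) by (auto simp: b0_def b1_def b2_def)
  have pb: "path_in (p +++ reversepath b1)" "path_in (r +++ b2)" "path_in (b1 +++ (r +++ b2))"
      "path_in (reversepath b1 +++ (b1 +++ (r +++ b2)))" "path_in (p +++ (r +++ b2))"
    using b pr by (auto intro!: path_in_join)
  have "eval p \<otimes>\<^bsub>fundamental_group S x\<^esub> eval r =
      path_class S ((b0 +++ (p +++ reversepath b1)) +++ (b1 +++ (r +++ b2)))"
    using loop_at_base[OF pr(1)] loop_at_base[OF pr(2)] pr(3)
    by (simp add: eval_def b0_def b1_def b2_def mult_fundamental_group)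
  also have "\<dots> = path_class S (b0 +++ ((p +++ reversepath b1) +++ (b1 +++ (r +++ b2))))"
    using b pb pr by (intro class_assoc) auto
  also have "\<dots> = path_class S (b0 +++ (p +++ (reversepath b1 +++ (b1 +++ (r +++ b2)))))"
    using b pb pr by (intro class_join_cong class_assoc refl path_in_join) auto
  also have "\<dots> = path_class S (b0 +++ (p +++ (r +++ b2)))"
    using b pb pr by (intro class_join_cong class_cancel refl path_in_join) auto
  also have "\<dots> = path_class S (b0 +++ ((p +++ r) +++ b2))"
    using b pb pr by (intro class_join_cong class_assoc[symmetric] refl path_in_join) auto
  finally show ?thesis
    using pr(3) by (simp add: eval_def b0_def b2_def)
qed

text \<open>The constant path is homotopic to its own double, so its value is an idempotent of the
  group.\<close>

lemma eval_const:
  assumes "y \<in> S"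
  shows "eval (\<lambda>_. y) = \<one>\<^bsub>fundamental_group S x\<^esub>"
proof -
  have y: "path_in (\<lambda>_. y)" "pathfinish (\<lambda>_. y) = y" "pathstart (\<lambda>_. y) = y"
    using assms path_in_const by (auto simp: pathstart_def pathfinish_def)
  have "eval ((\<lambda>_. y) +++ (\<lambda>_. y)) = eval (\<lambda>_. y)"
    using y by (intro eval_homotopic homotopic_paths_const_left) (auto simp: path_in_def)
  then show ?thesis
    using eval_join[OF y(1) y(1)] y eval_closed[OF y(1)] by (metis r_cancel_one')
qed

lemma eval_loop:
  assumes l: "loop_at S x p"
  shows "eval p = path_class S p"
proof -
  have p: "path_in p" using l by (rule loop_at_path_in)
  have c: "pathstart (\<lambda>_. x) = x" "pathfinish (\<lambda>_. x) = x" "reversepath (\<lambda>_. x) = (\<lambda>_. x)"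
    by (auto simp: pathstart_def pathfinish_def reversepath_def)
  have "eval p = path_class S ((\<lambda>_. x) +++ (p +++ (\<lambda>_. x)))"
    using l by (simp add: eval_def loop_at_def base_x c)
  also have "\<dots> = path_class S (p +++ (\<lambda>_. x))"
    using path_in_join[OF p path_in_const[OF x_in]] l c
    by (intro path_class_eq homotopic_paths_const_left) (auto simp: path_in_def loop_at_def)
  also have "\<dots> = path_class S p"
    using l by (intro path_class_eq homotopic_paths_const_right) (auto simp: loop_at_def)
  finally show ?thesis .
qed

lemma carrier_eq_eval: "carrier (fundamental_group S x) = eval ` {p. loop_at S x p}"
  using eval_loop by (auto simp: carrier_fundamental_group image_iff)

end

lemma based_paths_exist:
  assumes "path_connected S" "x \<in> S"
  obtains base where "based_paths S x base"
proof -
  have "\<exists>g. path g \<and> path_image g \<subseteq> S \<and> pathstart g = x \<and> pathfinish g = y" if "y \<in> S" for y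
    using assms that by (auto simp: path_connected_def)
  then obtain g where g: "\<And>y. y \<in> S \<Longrightarrow>
      path (g y) \<and> path_image (g y) \<subseteq> S \<and> pathstart (g y) = x \<and> pathfinish (g y) = y"
    by metis
  have "based_paths S x (\<lambda>y. if y = x then (\<lambda>_. x) else g y)"
    using g assms(2) loop_at_const[OF assms(2)] by unfold_locales (auto simp: loop_at_def)
  then show ?thesis using that by blast
qed

section \<open>Characters of the fundamental group and first homology\<close>

text \<open>The pairing of a real cochain with an integral chain: \<open>f\<close> is extended
  additively from simplices to chains.\<close>

definition chain_eval :: "('b \<Rightarrow> real) \<Rightarrow> ('b \<Rightarrow>\<^sub>0 int) \<Rightarrow> real" where
  "chain_eval f c = (\<Sum>s\<in>Poly_Mapping.keys c. of_int (Poly_Mapping.lookup c s) * f s)"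

lemma chain_eval_superset:
  assumes "finite A" "Poly_Mapping.keys c \<subseteq> A"
  shows "chain_eval f c = (\<Sum>s\<in>A. of_int (Poly_Mapping.lookup c s) * f s)"
  unfolding chain_eval_def using assms
  by (intro sum.mono_neutral_left) (auto simp: in_keys_iff)

lemma chain_eval_0 [simp]: "chain_eval f 0 = 0"
  by (simp add: chain_eval_def)

lemma chain_eval_of [simp]: "chain_eval f (frag_of s) = f s"
  by (simp add: chain_eval_def)

lemma chain_eval_add: "chain_eval f (a + b) = chain_eval f a + chain_eval f b"
proof -
  let ?A = "Poly_Mapping.keys a \<union> Poly_Mapping.keys b"
  have "Poly_Mapping.keys (a + b) \<subseteq> ?A" by (rule Poly_Mapping.keys_add)
  then show ?thesis
    by (simp add: chain_eval_superset[of ?A] lookup_add algebra_simps sum.distrib)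
qed

lemma chain_eval_minus: "chain_eval f (- a) = - chain_eval f a"
  using chain_eval_add[of f a "- a"] by simp

lemma chain_eval_diff: "chain_eval f (a - b) = chain_eval f a - chain_eval f b"
  using chain_eval_add[of f a "- b"] by (simp add: chain_eval_minus)

section \<open>Singular simplices of dimension 1 and 2 as paths and homotopies\<close>

definition segment_point :: "real \<Rightarrow> nat \<Rightarrow> real" where
  "segment_point t = (\<lambda>i. if i = 0 then 1 - t else if i = 1 then t else 0)"

text \<open>Barycentric coordinates on the plane triangle whose corners (0,0), (1,0), (0,1) go to
  the vertices 0, 1, 2. Further coordinates are 0 because \<open>standard_simplex\<close> consists
  of functions on all natural numbers.\<close>

definition triangle_point :: "real \<times> real \<Rightarrow> nat \<Rightarrow> real" where
  "triangle_point u =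
     (\<lambda>i. if i = 0 then 1 - fst u - snd u else if i = 1 then fst u else if i = 2 then snd u else 0)"

definition edge_path :: "((nat \<Rightarrow> real) \<Rightarrow> 'a) \<Rightarrow> real \<Rightarrow> 'a" where
  "edge_path s = s \<circ> segment_point"

lemma segment_point_in: "t \<in> {0..1} \<Longrightarrow> segment_point t \<in> standard_simplex 1"
  by (auto simp: segment_point_def standard_simplex_def atMost_Suc)

lemma triangle_point_in:
  assumes "u \<in> {u. 0 \<le> fst u \<and> 0 \<le> snd u \<and> fst u + snd u \<le> 1}"
  shows "triangle_point u \<in> standard_simplex 2"
  using assms by (auto simp: triangle_point_def standard_simplex_def atMost_Suc numeral_2_eq_2)

text \<open>The standard simplex carries the product topology, so continuity of a parametrisation is
  checked one coordinate at a time.\<close>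

lemma singular_simplex_continuous:
  fixes g :: "'c::topological_space \<Rightarrow> nat \<Rightarrow> real" and s :: "(nat \<Rightarrow> real) \<Rightarrow> 'a::topological_space"
  assumes s: "singular_simplex p (top_of_set T) s"
    and g: "\<And>i. continuous_on S (\<lambda>t. g t i)" "g ` S \<subseteq> standard_simplex p"
  shows "continuous_on S (s \<circ> g)" "(s \<circ> g) ` S \<subseteq> T"
proof -
  have "continuous_map (top_of_set S) (subtopology (powertop_real UNIV) (standard_simplex p)) g"
    using g by (auto simp: continuous_map_in_subtopology continuous_map_componentwise image_subset_iff)
  moreover have "continuous_map (subtopology (powertop_real UNIV) (standard_simplex p)) (top_of_set T) s"
    using s by (simp add: singular_simplex_def)
  ultimately have "continuous_map (top_of_set S) (top_of_set T) (s \<circ> g)"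
    by (rule continuous_map_compose)
  then show "continuous_on S (s \<circ> g)" "(s \<circ> g) ` S \<subseteq> T"
    by (auto simp: continuous_map_in_subtopology image_subset_iff)
qed

lemma edge_path:
  assumes "singular_simplex 1 (top_of_set T) s"
  shows "path (edge_path s)" "path_image (edge_path s) \<subseteq> T"
proof -
  have "continuous_on {0..1} (\<lambda>t. segment_point t i)" for i
    unfolding segment_point_def by (cases "i = 0"; cases "i = 1") (auto intro!: continuous_intros)
  then show "path (edge_path s)" "path_image (edge_path s) \<subseteq> T"
    using singular_simplex_continuous[OF assms, of "{0..1}" segment_point] segment_point_in
    unfolding path_def path_image_def edge_path_def by blast+
qed

lemma edge_path_face:
  assumes "t \<in> {0..1}" "k \<le> 2"
  shows "edge_path (singular_face 2 k s) t = s (simplical_face k (segment_point t))"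
  using segment_point_in[OF assms(1)] by (simp add: edge_path_def singular_face_def)

text \<open>Faces 2, 0 and 1 are the edges from vertex 0 to 1, from 1 to 2 and from 0 to 2. In the
  convex triangle the path along the first two is homotopic to the third, and the simplex carries
  this homotopy into \<open>T\<close>. This is the cocycle relation at the level of paths.\<close>

lemma edge_path_boundary:
  fixes s :: "(nat \<Rightarrow> real) \<Rightarrow> 'a::topological_space"
  assumes s: "singular_simplex 2 (top_of_set T) s"
  shows "homotopic_paths T (edge_path (singular_face 2 2 s) +++ edge_path (singular_face 2 0 s))
    (edge_path (singular_face 2 1 s))"
    and "pathfinish (edge_path (singular_face 2 2 s)) = pathstart (edge_path (singular_face 2 0 s))"
proof -
  let ?S = "{u :: real \<times> real. 0 \<le> fst u \<and> 0 \<le> snd u \<and> fst u + snd u \<le> 1}"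
  let ?f = "s \<circ> triangle_point"
  have conv: "convex ?S"
  proof (rule convexI)
    fix u v :: "real \<times> real" and a b :: real
    assume uv: "u \<in> ?S" "v \<in> ?S" and ab: "0 \<le> a" "0 \<le> b" "a + b = 1"
    have "a * (fst u + snd u) + b * (fst v + snd v) \<le> a * 1 + b * 1"
      using uv ab by (intro add_mono mult_left_mono) auto
    then show "a *\<^sub>R u + b *\<^sub>R v \<in> ?S"
      using uv ab by (simp add: algebra_simps)
  qed
  have "continuous_on ?S (\<lambda>u. triangle_point u i)" for i
    unfolding triangle_point_def
    by (cases "i = 0"; cases "i = 1"; cases "i = 2") (auto intro!: continuous_intros)
  then have f: "continuous_on ?S ?f" "?f ` ?S \<subseteq> T"
    using singular_simplex_continuous[OF s, of ?S triangle_point] triangle_point_in by blast+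
  have seg: "path_image (linepath a b) \<subseteq> ?S" if "a \<in> ?S" "b \<in> ?S" for a b
    using that conv by (simp add: closed_segment_subset)
  let ?p0 = "?f \<circ> linepath (1, 0) (0, 1)" and ?p1 = "?f \<circ> linepath (0, 0) (0, 1)"
    and ?p2 = "?f \<circ> linepath (0, 0) (1, 0)"
  have faces: "edge_path (singular_face 2 0 s) t = ?p0 t" "edge_path (singular_face 2 1 s) t = ?p1 t"
    "edge_path (singular_face 2 2 s) t = ?p2 t" if "t \<in> {0..1}" for t
  proof -
    have "simplical_face 0 (segment_point t) = triangle_point (linepath (1, 0) (0, 1) t)"
      "simplical_face 1 (segment_point t) = triangle_point (linepath (0, 0) (0, 1) t)"
      "simplical_face 2 (segment_point t) = triangle_point (linepath (0, 0) (1, 0) t)"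
      by (auto simp: fun_eq_iff linepath_def triangle_point_def simplical_face_def segment_point_def)
    then show "edge_path (singular_face 2 0 s) t = ?p0 t" "edge_path (singular_face 2 1 s) t = ?p1 t"
      "edge_path (singular_face 2 2 s) t = ?p2 t"
      using that by (simp_all add: edge_path_face)
  qed
  have "homotopic_paths T (?f \<circ> (linepath (0, 0) (1, 0) +++ linepath (1, 0) (0, 1)))
      (?f \<circ> linepath (0, 0) (0, 1))"
    using seg by (intro homotopic_paths_convex_image[OF conv f]) (auto simp: path_image_join)
  then have "homotopic_paths T (?p2 +++ ?p0) ?p1"
    by (simp add: path_compose_join)
  moreover have sing: "singular_simplex 1 (top_of_set T) (singular_face 2 k s)" if "k \<le> 2" for k
    using singular_simplex_singular_face[OF s _ that] by simp
  have eq: "homotopic_paths T (edge_path (singular_face 2 0 s)) ?p0"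
    "homotopic_paths T (edge_path (singular_face 2 1 s)) ?p1"
    "homotopic_paths T (edge_path (singular_face 2 2 s)) ?p2"
    using homotopic_paths_eq[OF edge_path[OF sing[of 0]] faces(1)]
      homotopic_paths_eq[OF edge_path[OF sing[of 1]] faces(2)]
      homotopic_paths_eq[OF edge_path[OF sing[of 2]] faces(3)] by (simp_all add: comp_def)
  show fin: "pathfinish (edge_path (singular_face 2 2 s)) = pathstart (edge_path (singular_face 2 0 s))"
    using faces[of 0] faces[of 1] by (simp add: pathfinish_def pathstart_def linepath_def)
  show "homotopic_paths T (edge_path (singular_face 2 2 s) +++ edge_path (singular_face 2 0 s))
    (edge_path (singular_face 2 1 s))"
    using homotopic_paths_join[OF eq(3,1) fin] \<open>homotopic_paths T (?p2 +++ ?p0) ?p1\<close>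
      homotopic_paths_sym[OF eq(2)] homotopic_paths_trans by blast
qed

section \<open>Addition of homology classes and integral 2 by 2 matrices\<close>

lemma homology_class_mult:
  assumes "singular_relcycle 1 X {} a" "singular_relcycle 1 X {} b"
  shows "homologous_rel_set 1 X {} a \<otimes>\<^bsub>homology_group 1 X\<^esub> homologous_rel_set 1 X {} b
    = homologous_rel_set 1 X {} (a + b)"
proof -
  have hom: "homologous_rel_set 1 X {} \<in> hom (relcycle_group 1 X {}) (homology_group (int 1) X)"
    unfolding relative_homology_group_def
    using normal.r_coset_hom_Mod[OF normal_subgroup_singular_relboundary_relcycle[of 1 X "{}"]]
    by (simp add: right_coset_singular_relboundary)
  then show ?thesis
    using assms hom_mult[OF hom, of a b] by simp
qed

text \<open>The row vector (w e1, w e2) times A - 1 is zero. Surjectivity forces det A to be 1 or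
  -1, so det(A - 1) = det A - tr A + 1 is 2 - tr A or - tr A, and neither is 0 when |tr A| >
  2.\<close>

lemma no_invariant_functional:
  fixes A :: "int^2^2" and w :: "int^2 \<Rightarrow> real"
  assumes surj: "\<And>v. \<exists>u. A *v u = v" and tr: "\<bar>trace A\<bar> > 2"
    and add: "\<And>u v. w (u + v) = w u + w v" and inv: "\<And>v. w (A *v v) = w v"
  shows "w v = 0"
proof -
  have w0: "w 0 = 0" using add[of 0 0] by simp
  have wneg: "w (- u) = - w u" for u using add[of u "- u"] w0 by simp
  have wnat: "w (of_nat n *s u) = of_nat n * w u" for n u
    by (induction n) (auto simp: w0 add algebra_simps vector_sadd_rdistrib)
  have wint: "w (k *s u) = of_int k * w u" for k :: int and u
  proof (cases k rule: int_cases2)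
    case (nonneg n)
    then show ?thesis using wnat[of n u] by simp
  next
    case (nonpos n)
    then have "k *s u = - (of_nat n *s u)" by (simp add: vec_eq_iff)
    then show ?thesis using wnat[of n u] wneg nonpos by simp
  qed
  define e1 e2 :: "int^2" where "e1 = axis 1 1" and "e2 = axis 2 1"
  define a b c d where "a = A$1$1" and "b = A$1$2" and "c = A$2$1" and "d = A$2$2"
  have comb: "w u = of_int (u$1) * w e1 + of_int (u$2) * w e2" for u
  proof -
    have "u = u$1 *s e1 + u$2 *s e2"
      by (simp add: vec_eq_iff forall_2 e1_def e2_def axis_def)
    then show ?thesis using add wint by metis
  qed
  have mult: "(A *v u)$1 = a * u$1 + b * u$2" "(A *v u)$2 = c * u$1 + d * u$2" for u
    by (simp_all add: matrix_vector_mult_def sum_2 a_def b_def c_def d_def)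
  have e: "e1$1 = 1" "e1$2 = 0" "e2$1 = 0" "e2$2 = 1"
    by (simp_all add: e1_def e2_def axis_def)
  have eq1: "of_int a * w e1 + of_int c * w e2 = w e1"
    using inv[of e1] comb[of "A *v e1"] by (simp add: mult e)
  have eq2: "of_int b * w e1 + of_int d * w e2 = w e2"
    using inv[of e2] comb[of "A *v e2"] by (simp add: mult e)
  obtain u1 u2 where u: "A *v u1 = e1" "A *v u2 = e2" using surj by blast
  have m: "a * u1$1 + b * u1$2 = 1" "c * u1$1 + d * u1$2 = 0"
    "a * u2$1 + b * u2$2 = 0" "c * u2$1 + d * u2$2 = 1"
    using mult[of u1] mult[of u2] u e by simp_all
  \<comment> \<open>Multiplicativity of the determinant for A and the matrix with columns u1 and u2,
    whose product is the identity.\<close>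
  have "(a * d - b * c) * (u1$1 * u2$2 - u1$2 * u2$1) =
      (a * u1$1 + b * u1$2) * (c * u2$1 + d * u2$2) - (a * u2$1 + b * u2$2) * (c * u1$1 + d * u1$2)"
    by (simp add: algebra_simps)
  then have "(a * d - b * c) * (u1$1 * u2$2 - u1$2 * u2$1) = 1"
    unfolding m by simp
  then have det: "a * d - b * c = 1 \<or> a * d - b * c = -1"
    by (auto simp: zmult_eq_1_iff)
  have "\<bar>a + d\<bar> > 2" using tr by (simp add: trace_def sum_2 a_def d_def)
  then have "(a - 1) * (d - 1) - b * c \<noteq> 0"
    using det by (auto simp: algebra_simps)
  then have nz: "real_of_int ((a - 1) * (d - 1) - b * c) \<noteq> 0"
    by (metis of_int_eq_0_iff)
  have z: "(of_int a - 1) * w e1 + of_int c * w e2 = 0" "of_int b * w e1 + (of_int d - 1) * w e2 = 0"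
    using eq1 eq2 by (simp_all add: algebra_simps)
  \<comment> \<open>Cramer's rule: the equations \<open>z\<close> are combined with the entries of
    the adjugate of A - 1.\<close>
  have "of_int ((a - 1) * (d - 1) - b * c) * w e1 =
      (of_int d - 1) * ((of_int a - 1) * w e1 + of_int c * w e2)
        - of_int c * (of_int b * w e1 + (of_int d - 1) * w e2)"
    "of_int ((a - 1) * (d - 1) - b * c) * w e2 =
      (of_int a - 1) * (of_int b * w e1 + (of_int d - 1) * w e2)
        - of_int b * ((of_int a - 1) * w e1 + of_int c * w e2)"
    by (simp_all add: algebra_simps)
  then have "of_int ((a - 1) * (d - 1) - b * c) * w e1 = 0" "of_int ((a - 1) * (d - 1) - b * c) * w e2 = 0"
    unfolding z by simp_all
  then have "w e1 = 0" "w e2 = 0" using nz by (metis mult_eq_0_iff)+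
  then show ?thesis using comb[of v] by simp
qed


text \<open>
  A character of the fundamental group is a 1-cocycle, and the cocycles of a character and of its
  pullback along a map differ by the coboundary of a function on the space. On homology this
  gives a functional on \<open>\<int>\<^sup>2\<close> that is invariant under the matrix, whose eigenvalues differ from 1.
\<close>

theorem (in based_paths) invariant_character_trivial:
  fixes f :: "(real \<Rightarrow> 'a) set \<Rightarrow> real"
  assumes add: "\<And>u v. \<lbrakk>u \<in> carrier (fundamental_group S x); v \<in> carrier (fundamental_group S x)\<rbrakk>
      \<Longrightarrow> f (u \<otimes>\<^bsub>fundamental_group S x\<^esub> v) = f u + f v"
    and homeo: "homeomorphism S S h h'" and hx: "h x = x"
    and inv: "\<And>p. loop_at S x p \<Longrightarrow> f (path_class S (h \<circ> p)) = f (path_class S p)"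
    and rep: "represents_on_H1 S h A" and hyp: "hyperbolic A"
    and l: "loop_at S x l"
  shows "f (path_class S l) = 0"
proof -
  let ?X = "top_of_set S"
  have hS: "continuous_on S h" "h ` S \<subseteq> S" "continuous_on S h'" "h' ` S \<subseteq> S"
    and hh': "\<And>y. y \<in> S \<Longrightarrow> h (h' y) = y"
    using homeo by (auto simp: homeomorphism_def)
  have cm: "continuous_map ?X ?X h" "continuous_map ?X ?X h'"
    using hS by (auto simp: continuous_map_in_subtopology image_subset_iff)
  define F where "F p = f (eval p)" for p
  have F_join: "F (p +++ r) = F p + F r" if "path_in p" "path_in r" "pathfinish p = pathstart r" for p r
    using that by (simp add: F_def eval_join add)
  have F_hom: "F p = F r" if "homotopic_paths S p r" for p r
    using eval_homotopic[OF that] by (simp add: F_def)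
  have F_rev: "F (reversepath p) = - F p" if "path_in p" for p
  proof -
    have "F (p +++ reversepath p) = F (\<lambda>_. pathstart p)"
      using that by (intro F_hom homotopic_paths_reversepath_right) (auto simp: path_in_def)
    moreover have "F (\<lambda>_. pathstart p) = f \<one>\<^bsub>fundamental_group S x\<^esub>"
      using path_in_ends[OF that] by (simp add: F_def eval_const)
    moreover have "f \<one>\<^bsub>fundamental_group S x\<^esub> = 0"
      using add[OF one_closed one_closed] by simp
    ultimately show ?thesis using F_join[of p "reversepath p"] that by simp
  qed
  have path_h: "path_in (h \<circ> p)" if "path_in p" for p
    using that hS path_continuous_image[of p h] unfolding path_in_def path_image_compose
    by (meson continuous_on_subset image_mono order_trans)
  \<comment> \<open>Invariance is given for loops, so a path is closed up by base paths at both
    ends. The map \<open>h\<close> moves these base paths, and \<open>d\<close> records the value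
    picked up; it is the function whose coboundary separates the two cocycles.\<close>
  define d where "d y = F (h \<circ> base y)" for y
  have F_h: "F (h \<circ> p) = F p + d (pathfinish p) - d (pathstart p)" if p: "path_in p" for p
  proof -
    let ?b0 = "base (pathstart p)" and ?b1 = "base (pathfinish p)"
    let ?l = "?b0 +++ (p +++ reversepath ?b1)"
    have ends: "pathstart p \<in> S" "pathfinish p \<in> S" using path_in_ends[OF p] .
    have l: "loop_at S x ?l" using loop_at_base[OF p] .
    have hl: "loop_at S x (h \<circ> ?l)" using loop_at_compose[OF l hS(1,2)] hx by simp
    have b: "path_in ?b0" "path_in ?b1" using path_in_base ends by auto
    have "f (path_class S (h \<circ> ?l)) = F (h \<circ> ?l)"
      using eval_loop[OF hl] by (simp add: F_def)
    also have "\<dots> = F ((h \<circ> ?b0) +++ ((h \<circ> p) +++ reversepath (h \<circ> ?b1)))"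
      by (simp add: path_compose_join path_compose_reversepath)
    also have "\<dots> = d (pathstart p) + (F (h \<circ> p) - d (pathfinish p))"
      using b p ends base path_h
      by (simp add: F_join F_rev path_in_join d_def pathstart_compose pathfinish_compose)
    finally have "f (path_class S (h \<circ> ?l)) = d (pathstart p) + F (h \<circ> p) - d (pathfinish p)"
      by simp
    then show ?thesis
      using inv[OF l] by (simp add: F_def eval_def)
  qed
  define \<phi> where "\<phi> s = F (edge_path s)" for s :: "(nat \<Rightarrow> real) \<Rightarrow> 'a"
  have edge_in: "path_in (edge_path s)" if "singular_simplex 1 ?X s" for s
    using edge_path[OF that] by (simp add: path_in_def)
  \<comment> \<open>The faces of a 2-simplex enter with signs +, -, +, which is the relation of
    \<open>edge_path_boundary\<close>. Hence homologous chains have equal values.\<close>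
  have bnd: "chain_eval \<phi> (chain_boundary 2 c) = 0" if "singular_chain 2 ?X c" for c
    using that unfolding singular_chain_def
  proof (induction rule: frag_induction)
    case (one s)
    then have s: "singular_simplex 2 ?X s" by simp
    have face: "path_in (edge_path (singular_face 2 k s))" if "k \<le> 2" for k
      using singular_simplex_singular_face[OF s _ that] by (intro edge_in) simp
    have "F (edge_path (singular_face 2 2 s)) + F (edge_path (singular_face 2 0 s)) =
        F (edge_path (singular_face 2 1 s))"
      using F_hom[OF edge_path_boundary(1)[OF s]] face edge_path_boundary(2)[OF s]
      by (simp add: F_join)
    then show ?case
      by (simp add: chain_boundary_of numeral_2_eq_2 chain_eval_add chain_eval_diff \<phi>_def)
  qed (simp_all add: chain_boundary_diff chain_eval_diff)
  \<comment> \<open>A singular 0-simplex is read off at the only point of its domain,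
    \<open>segment_point 0\<close>. Applying \<open>h\<close> to a 1-chain changes the value by
    \<open>D\<close> of its boundary, hence not at all on cycles.\<close>
  define D where "D s = d (s (segment_point 0))" for s :: "(nat \<Rightarrow> real) \<Rightarrow> 'a"
  have map: "chain_eval \<phi> (chain_map 1 h c) = chain_eval \<phi> c + chain_eval D (chain_boundary 1 c)"
    if "singular_chain 1 ?X c" for c
    using that unfolding singular_chain_def
  proof (induction rule: frag_induction)
    case (one s)
    then have s: "singular_simplex 1 ?X s" by simp
    have "homotopic_paths S (h \<circ> edge_path s) (edge_path (simplex_map 1 h s))"
      using path_h[OF edge_in[OF s]] segment_point_in
      by (intro homotopic_paths_eq) (auto simp: path_in_def edge_path_def simplex_map_def)
    then have "\<phi> (simplex_map 1 h s) = F (h \<circ> edge_path s)"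
      using F_hom by (simp add: \<phi>_def)
    moreover have "D (singular_face 1 0 s) = d (pathfinish (edge_path s))"
      "D (singular_face 1 1 s) = d (pathstart (edge_path s))"
    proof -
      have "segment_point 0 \<in> standard_simplex 0"
        by (auto simp: standard_simplex_0 segment_point_def)
      moreover have "simplical_face 0 (segment_point 0) = segment_point 1"
        "simplical_face 1 (segment_point 0) = segment_point 0"
        by (auto simp: fun_eq_iff simplical_face_def segment_point_def)
      ultimately show "D (singular_face 1 0 s) = d (pathfinish (edge_path s))"
        "D (singular_face 1 1 s) = d (pathstart (edge_path s))"
        by (simp_all add: D_def singular_face_def edge_path_def pathstart_def pathfinish_def)
    qed
    ultimately show ?case
      using F_h[OF edge_in[OF s]] by (simp add: chain_boundary_of chain_eval_diff \<phi>_def)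
  qed (simp_all add: chain_map_diff chain_boundary_diff chain_eval_diff)
  have bd_eq: "chain_eval \<phi> a = chain_eval \<phi> b"
    if "homologous_rel_set 1 ?X {} a = homologous_rel_set 1 ?X {} b" for a b
  proof -
    have "homologous_rel 1 ?X {} a b"
      using that homologous_rel_set_eq by metis
    then have "\<exists>e. singular_chain (Suc 1) ?X e \<and> chain_boundary (Suc 1) e = a - b"
      unfolding homologous_rel_def singular_boundary .
    then obtain e where "singular_chain 2 ?X e" "chain_boundary 2 e = a - b"
      by (auto simp: numeral_2_eq_2)
    then show ?thesis using bnd[of e] by (simp add: chain_eval_diff)
  qed
  obtain \<psi> where iso: "\<psi> \<in> iso (homology_group 1 ?X) int_plane"
    and \<psi>: "\<And>c. c \<in> carrier (homology_group 1 ?X) \<Longrightarrow> \<psi> (hom_induced 1 ?X {} ?X {} h c) = A *v \<psi> c"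
    using rep by (auto simp: represents_on_H1_def)
  let ?cls = "homologous_rel_set 1 ?X {}" and ?Z = "singular_relcycle 1 ?X {}"
  have carr: "carrier (homology_group 1 ?X) = ?cls ` Collect ?Z"
    using carrier_relative_homology_group[of 1 ?X "{}"] by simp
  have bij: "bij_betw \<psi> (carrier (homology_group 1 ?X)) UNIV"
    using iso by (simp add: iso_def int_plane_def)
  have "\<exists>c. ?Z c \<and> \<psi> (?cls c) = v" for v
  proof -
    have "v \<in> \<psi> ` ?cls ` Collect ?Z"
      using bij unfolding carr bij_betw_def by simp
    then show ?thesis by blast
  qed
  \<comment> \<open>One cycle is chosen for each integral vector; by \<open>bd_eq\<close> and
    injectivity of \<open>\<psi>\<close> the value does not depend on the choice.\<close>
  then obtain c where c: "\<And>v. ?Z (c v)" "\<And>v. \<psi> (?cls (c v)) = v"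
    by metis
  define w where "w v = chain_eval \<phi> (c v)" for v
  have w: "chain_eval \<phi> b = w (\<psi> (?cls b))" if "?Z b" for b
  proof -
    have "?cls b = ?cls (c (\<psi> (?cls b)))"
      using bij that c carr unfolding bij_betw_def by (intro inj_onD[of \<psi>]) auto
    then show ?thesis unfolding w_def by (rule bd_eq)
  qed
  have ind: "hom_induced 1 ?X {} ?X {} g (?cls b) = ?cls (chain_map 1 g b)"
    if "continuous_map ?X ?X g" "?Z b" for g b
    using hom_induced_chain_map[of ?X ?X g "{}" "{}" 1 b] that by simp
  have Zmap: "?Z (chain_map 1 g b)" if "continuous_map ?X ?X g" "?Z b" for g b
    using that by (intro singular_relcycle_chain_map) auto
  have "w v = 0" for v
  proof (rule no_invariant_functional)
    show "\<bar>trace A\<bar> > 2" using hyp by (simp add: hyperbolic_def)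
    show "w (u + v) = w u + w v" for u v
    proof -
      have "\<psi> (?cls (c u + c v)) = \<psi> (?cls (c u) \<otimes>\<^bsub>homology_group 1 ?X\<^esub> ?cls (c v))"
        using homology_class_mult[OF c(1) c(1)] by simp
      also have "\<dots> = u + v"
        using hom_mult[of \<psi> "homology_group 1 ?X" int_plane "?cls (c u)" "?cls (c v)"] iso c carr
        by (simp add: iso_def int_plane_def)
      finally show ?thesis
        using w[OF singular_relcycle_add[OF c(1) c(1)], of u v] by (simp add: chain_eval_add w_def)
    qed
    show "w (A *v v) = w v" for v
    proof -
      have "\<psi> (?cls (chain_map 1 h (c v))) = A *v v"
        using \<psi>[of "?cls (c v)"] c carr ind[OF cm(1) c(1)] by simp
      moreover have "singular_chain 1 ?X (c v)" "chain_boundary 1 (c v) = 0"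
        using c(1)[of v] by (simp_all add: singular_cycle)
      ultimately show ?thesis
        using w[OF Zmap[OF cm(1) c(1)], of v] map[of "c v"] by (simp add: w_def)
    qed
    \<comment> \<open>The inverse homeomorphism supplies the preimage: push the chosen cycle for v
      forward by \<open>h'\<close> and take the coordinates of its class.\<close>
    show "\<exists>u. A *v u = v" for v
    proof -
      let ?u = "hom_induced 1 ?X {} ?X {} h' (?cls (c v))"
      have "hom_induced 1 ?X {} ?X {} h ?u = hom_induced 1 ?X {} ?X {} (h \<circ> h') (?cls (c v))"
        by (simp only: hom_induced_compose_empty[OF cm(2,1)] comp_apply)
      also have "\<dots> = ?cls (c v)"
        using hh' c carr by (intro hom_induced_id_gen continuous_map_compose[OF cm(2,1)]) auto
      finally have "A *v \<psi> ?u = v"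
        using \<psi>[of ?u] c ind[OF cm(2) c(1)] Zmap[OF cm(2) c(1)] carr by simp
      then show ?thesis by blast
    qed
  qed
  then have cycle0: "chain_eval \<phi> b = 0" if "?Z b" for b
    using w[OF that] by simp
  \<comment> \<open>The loop becomes a 1-simplex with barycentric coordinate 1 as time;
    \<open>restrict\<close> is there because singular simplices are extensional. Its two faces agree
    since l is closed, so it is a cycle.\<close>
  define s where "s = restrict (l \<circ> (\<lambda>v. v 1)) (standard_simplex 1)"
  have lpath: "path l" "path_image l \<subseteq> S" "pathstart l = x" "pathfinish l = x"
    using l by (auto simp: loop_at_def)
  have s: "singular_simplex 1 ?X s"
  proof -
    have "continuous_map (subtopology (powertop_real UNIV) (standard_simplex 1)) (top_of_set {0..1}) (\<lambda>v. v 1)"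
      by (auto simp: continuous_map_in_subtopology standard_simplex_def
          intro!: continuous_map_from_subtopology continuous_map_product_projection)
    moreover have "continuous_map (top_of_set {0..1}) ?X l"
      using lpath by (auto simp: continuous_map_in_subtopology path_def path_image_def)
    ultimately have "continuous_map (subtopology (powertop_real UNIV) (standard_simplex 1)) ?X (l \<circ> (\<lambda>v. v 1))"
      by (rule continuous_map_compose)
    then show ?thesis
      by (simp add: singular_simplex_def s_def)
  qed
  have s_edge: "edge_path s t = l t" if "t \<in> {0..1}" for t
    using segment_point_in[OF that] by (simp add: s_def edge_path_def segment_point_def)
  have "singular_face 1 0 s = singular_face 1 1 s"
  proof -
    have "s (simplical_face 0 v) = s (simplical_face 1 v)" if "v \<in> standard_simplex 0" for v
    proof -
      have v: "v = segment_point 0"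
        using that by (auto simp: standard_simplex_0 segment_point_def)
      have "simplical_face 0 v = segment_point 1" "simplical_face 1 v = segment_point 0"
        by (auto simp: v fun_eq_iff simplical_face_def segment_point_def)
      then show ?thesis
        using s_edge[of 0] s_edge[of 1] lpath
        by (simp add: edge_path_def pathstart_def pathfinish_def)
    qed
    then show ?thesis
      by (auto simp: singular_face_def fun_eq_iff restrict_def)
  qed
  then have "?Z (frag_of s)"
    using s by (simp add: singular_cycle singular_chain_of chain_boundary_of)
  then have "F (edge_path s) = 0"
    using cycle0[of "frag_of s"] by (simp add: \<phi>_def)
  moreover have "homotopic_paths S l (edge_path s)"
    using lpath s_edge by (intro homotopic_paths_eq) auto
  ultimately have "F l = 0" using F_hom by metis
  then show ?thesis using eval_loop[OF l] by (simp add: F_def)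
qed

section \<open>The fundamental group of the punctured torus\<close>

definition torus_cover :: "real \<times> real \<Rightarrow> complex \<times> complex" where
  "torus_cover u = (cis (fst u), cis (snd u))"

definition center :: "int \<Rightarrow> int \<Rightarrow> real \<times> real" where
  "center m n = (pi * (2 * of_int m + 1), pi * (2 * of_int n + 1))"

text \<open>Component number m of the set where the cosine of the first coordinate is \<le> 0: a
  vertical strip of width pi around an odd multiple of pi.\<close>

definition column :: "int \<Rightarrow> (real \<times> real) set" where
  "column m = {u. \<bar>fst u - pi * (2 * of_int m + 1)\<bar> \<le> pi / 2}"

definition row :: "int \<Rightarrow> (real \<times> real) set" where
  "row n = {u. \<bar>snd u - pi * (2 * of_int n + 1)\<bar> \<le> pi / 2}"

text \<open>The preimage of \<open>model_torus\<close> in the plane: open squares of side pi around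
  the points with both coordinates in 2 pi \<int> are removed, which leaves a thickened square
  lattice.\<close>

definition grid :: "(real \<times> real) set" where
  "grid = (\<Union>m. column m) \<union> (\<Union>n. row n)"

lemma cos_nonpos_iff: "cos a \<le> 0 \<longleftrightarrow> (\<exists>m::int. \<bar>a - pi * (2 * of_int m + 1)\<bar> \<le> pi / 2)"
proof
  assume a: "cos a \<le> 0"
  define m where "m = \<lfloor>a / (2 * pi)\<rfloor>"
  have m: "of_int m \<le> a / (2 * pi)" "a / (2 * pi) < of_int m + 1"
    by (simp_all add: m_def)
  \<comment> \<open>Measured from the odd multiple of pi in the middle of its period, a becomes a
    number b in [-pi, pi] with cos a = - cos b.\<close>
  define b where "b = a - 2 * pi * of_int m - pi"
  have b: "-pi \<le> b" "b \<le> pi"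
    using m by (simp_all add: b_def field_simps)
  have "cos a = cos (b + pi + 2 * pi * of_int m)" by (simp add: b_def)
  also have "\<dots> = - cos b"
    using cos_int_2pin[of m] sin_int_2pin[of m] by (simp add: cos_add mult.assoc)
  finally have "0 \<le> cos b" using a by simp
  then have "\<bar>b\<bar> \<le> pi / 2"
    using b cos_monotone_0_pi[of "pi/2" "\<bar>b\<bar>"] cos_abs_real[of b] by (cases "\<bar>b\<bar> \<le> pi/2") (auto simp: abs_le_iff)
  then show "\<exists>m::int. \<bar>a - pi * (2 * of_int m + 1)\<bar> \<le> pi / 2"
    by (intro exI[of _ m]) (simp add: b_def algebra_simps)
next
  assume "\<exists>m::int. \<bar>a - pi * (2 * of_int m + 1)\<bar> \<le> pi / 2"
  then obtain m :: int where m: "\<bar>a - pi * (2 * of_int m + 1)\<bar> \<le> pi / 2" by blast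
  define b where "b = a - pi * (2 * of_int m + 1)"
  have "cos a = cos (b + pi + 2 * pi * of_int m)" by (simp add: b_def algebra_simps)
  also have "\<dots> = - cos b"
    using cos_int_2pin[of m] sin_int_2pin[of m] by (simp add: cos_add mult.assoc)
  finally have "cos a = - cos b" .
  moreover have "- (pi / 2) \<le> b" "b \<le> pi / 2"
    using m unfolding b_def by linarith+
  ultimately show "cos a \<le> 0"
    using cos_ge_zero[of b] by simp
qed

lemma torus_cover_in_iff: "torus_cover u \<in> model_torus \<longleftrightarrow> u \<in> grid"
  by (simp add: torus_cover_def model_torus_def grid_def column_def row_def cos_nonpos_iff)

lemma torus_cover_surj:
  assumes "y \<in> model_torus" obtains u where "u \<in> grid" "torus_cover u = y"
proof -
  obtain z w where y: "y = (z, w)" by force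
  have "norm z = 1" "norm w = 1" using assms by (auto simp: model_torus_def y)
  then have "torus_cover (Arg z, Arg w) = y"
    by (simp add: torus_cover_def y cis_Arg_unique flip: cis_Arg)
      (metis cis_Arg norm_zero sgn_eq zero_neq_one div_by_1 of_real_1)
  then show ?thesis using that assms torus_cover_in_iff by metis
qed

lemma torus_cover_periodic:
  "torus_cover (fst u + 2 * pi * of_int m, snd u + 2 * pi * of_int n) = torus_cover u"
proof -
  have "cis (a + 2 * pi * of_int k) = cis a" for a and k :: int
    using cos_int_2pin[of k] sin_int_2pin[of k]
    by (simp add: complex_eq_iff cos_add sin_add mult.assoc)
  then show ?thesis by (simp add: torus_cover_def)
qed

lemma continuous_on_torus_cover: "continuous_on S torus_cover"
  unfolding torus_cover_def by (intro continuous_intros)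

text \<open>The interval is contractible, so a path avoiding 0 has a continuous logarithm. On the
  unit circle its real part vanishes and its imaginary part is the required angle.\<close>

lemma path_lift_circle:
  assumes "path p" "\<And>t. t \<in> {0..1} \<Longrightarrow> norm (p t) = 1"
  obtains a where "path a" "\<And>t. t \<in> {0..1} \<Longrightarrow> p t = cis (a t)"
proof -
  have "continuous_on {0..1} p" using assms by (simp add: path_def)
  moreover have "contractible {0..1::real}" by (intro convex_imp_contractible) simp
  moreover have "p t \<noteq> 0" if "t \<in> {0..1}" for t using assms(2)[OF that] by auto
  ultimately obtain g where g: "continuous_on {0..1} g" "\<And>t. t \<in> {0..1} \<Longrightarrow> p t = exp (g t)"
    using continuous_logarithm_on_contractible by metis
  show ?thesis
  proof
    show "path (\<lambda>t. Im (g t))" using g by (auto simp: path_def intro!: continuous_intros)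
    fix t :: real assume t: "t \<in> {0..1}"
    have "exp (Re (g t)) = 1" using assms(2)[OF t] g(2)[OF t] by simp
    then show "p t = cis (Im (g t))"
      using g(2)[OF t] by (simp add: exp_eq_polar)
  qed
qed

lemma torus_path_lift:
  assumes "path p" "path_image p \<subseteq> model_torus"
  obtains s where "path s" "path_image s \<subseteq> grid" "\<And>t. t \<in> {0..1} \<Longrightarrow> p t = torus_cover (s t)"
proof -
  have pt: "p t \<in> model_torus" if "t \<in> {0..1}" for t
    using assms(2) that by (auto simp: path_image_def)
  have c: "path (fst \<circ> p)" "path (snd \<circ> p)"
    using assms(1) by (auto simp: path_def intro!: continuous_intros continuous_on_compose)
  have n: "norm ((fst \<circ> p) t) = 1" "norm ((snd \<circ> p) t) = 1" if "t \<in> {0..1}" for t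
    using pt[OF that] by (auto simp: model_torus_def case_prod_beta)
  obtain a where a: "path a" "\<And>t. t \<in> {0..1} \<Longrightarrow> (fst \<circ> p) t = cis (a t)"
    using path_lift_circle[OF c(1) n(1)] by metis
  obtain b where b: "path b" "\<And>t. t \<in> {0..1} \<Longrightarrow> (snd \<circ> p) t = cis (b t)"
    using path_lift_circle[OF c(2) n(2)] by metis
  have eq: "p t = torus_cover (a t, b t)" if "t \<in> {0..1}" for t
    using a(2)[OF that] b(2)[OF that] by (simp add: torus_cover_def prod_eq_iff)
  show ?thesis
  proof
    show "path (\<lambda>t. (a t, b t))" using a b by (auto simp: path_def intro!: continuous_intros)
    show "path_image (\<lambda>t. (a t, b t)) \<subseteq> grid"
      using eq pt torus_cover_in_iff by (auto simp: path_image_def)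
  qed (use eq in auto)
qed

section \<open>Geometry of columns, rows and crosses\<close>

lemma convex_column: "convex (column m)"
proof -
  have "column m = (\<lambda>u. fst u) -` cball (pi * (2 * of_int m + 1)) (pi / 2)"
    by (auto simp: column_def dist_real_def abs_minus_commute)
  then show ?thesis by (simp add: convex_linear_vimage linear_fst)
qed

lemma convex_row: "convex (row n)"
proof -
  have "row n = (\<lambda>u. snd u) -` cball (pi * (2 * of_int n + 1)) (pi / 2)"
    by (auto simp: row_def dist_real_def abs_minus_commute)
  then show ?thesis by (simp add: convex_linear_vimage linear_snd)
qed

lemma center_in [simp]: "center m n \<in> column m" "center m n \<in> row n"
  by (simp_all add: center_def column_def row_def)

definition cross :: "int \<Rightarrow> int \<Rightarrow> (real \<times> real) set" where
  "cross m n = column m \<union> row n"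

lemma column_grid: "column m \<subseteq> grid" and row_grid: "row n \<subseteq> grid" and cross_grid: "cross m n \<subseteq> grid"
  by (auto simp: grid_def cross_def)

lemma grid_cross: "u \<in> grid \<Longrightarrow> \<exists>m n. u \<in> cross m n"
  by (auto simp: grid_def cross_def)

text \<open>The strips have width pi and their centre lines are multiples of 2 pi apart, so distinct
  strips are separated by a gap of at least pi > 3. This is the origin of the constant 3 in the
  subdivision argument.\<close>

lemma column_unique: "u \<in> column m \<Longrightarrow> v \<in> column m' \<Longrightarrow> \<bar>fst u - fst v\<bar> < 3 \<Longrightarrow> m = m'"
proof (rule ccontr)
  assume u: "u \<in> column m" "v \<in> column m'" "\<bar>fst u - fst v\<bar> < 3" and "m \<noteq> m'"
  then have "1 \<le> \<bar>real_of_int m - real_of_int m'\<bar>" by linarith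
  then have "2 * pi * 1 \<le> 2 * pi * \<bar>real_of_int m - real_of_int m'\<bar>" by (intro mult_left_mono) auto
  then have "2 * pi \<le> \<bar>2 * pi * (real_of_int m - real_of_int m')\<bar>" by (simp add: abs_mult)
  moreover have "\<bar>pi * (2 * of_int m + 1) - pi * (2 * of_int m' + 1)\<bar> \<le> pi + \<bar>fst u - fst v\<bar>"
    using u unfolding column_def mem_Collect_eq by linarith
  moreover have "pi * (2 * of_int m + 1) - pi * (2 * of_int m' + 1) = 2 * pi * (real_of_int m - real_of_int m')"
    by (simp add: algebra_simps)
  ultimately show False using u pi_gt3 by linarith
qed

lemma row_unique: "u \<in> row n \<Longrightarrow> v \<in> row n' \<Longrightarrow> \<bar>snd u - snd v\<bar> < 3 \<Longrightarrow> n = n'"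
  using column_unique[of "prod.swap u" n "prod.swap v" n'] by (simp add: column_def row_def)

text \<open>Because of the gaps a set this small meets at most one column and at most one row. An
  index for which there is no such strip is arbitrary.\<close>

lemma small_set_in_cross:
  assumes "X \<subseteq> grid" and small: "\<And>u v. u \<in> X \<Longrightarrow> v \<in> X \<Longrightarrow> dist u v < 3"
  obtains m n where "X \<subseteq> cross m n"
proof -
  have fs: "\<bar>fst u - fst v\<bar> < 3" "\<bar>snd u - snd v\<bar> < 3" if "u \<in> X" "v \<in> X" for u v
    using small[OF that] dist_fst_le[of u v] dist_snd_le[of u v] by (auto simp: dist_real_def)
  have "\<exists>m. \<forall>u\<in>X. \<forall>m'. u \<in> column m' \<longrightarrow> m' = m"
    using column_unique fs(1) by (cases "\<exists>u\<in>X. \<exists>m. u \<in> column m") blast+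
  then obtain m where m: "\<And>u m'. u \<in> X \<Longrightarrow> u \<in> column m' \<Longrightarrow> m' = m" by blast
  have "\<exists>n. \<forall>u\<in>X. \<forall>n'. u \<in> row n' \<longrightarrow> n' = n"
    using row_unique fs(2) by (cases "\<exists>u\<in>X. \<exists>n. u \<in> row n") blast+
  then obtain n where n: "\<And>u n'. u \<in> X \<Longrightarrow> u \<in> row n' \<Longrightarrow> n' = n" by blast
  have "X \<subseteq> cross m n"
  proof
    fix u assume "u \<in> X"
    moreover have "(\<exists>m'. u \<in> column m') \<or> (\<exists>n'. u \<in> row n')"
      using assms(1) \<open>u \<in> X\<close> by (auto simp: grid_def)
    ultimately show "u \<in> cross m n" using m n unfolding cross_def by blast
  qed
  then show ?thesis by (rule that)
qed

text \<open>A column and a row are convex and both contain the centre, so their union is starlike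
  about it.\<close>

lemma simply_connected_cross: "simply_connected (cross m n)"
proof (rule starlike_imp_simply_connected)
  have "closed_segment (center m n) u \<subseteq> cross m n" if "u \<in> cross m n" for u
    using that closed_segment_subset[OF _ _ convex_column, of "center m n" m u]
      closed_segment_subset[OF _ _ convex_row, of "center m n" n u]
    by (auto simp: cross_def)
  then show "starlike (cross m n)"
    unfolding starlike_def by (intro bexI[of _ "center m n"]) (auto simp: cross_def)
qed

text \<open>Every point lifts into some cross and is joined there to the centre; all centres lie
  over (-1,-1).\<close>

lemma path_connected_model_torus: "path_connected model_torus"
  unfolding path_connected_def
proof -
  have *: "\<exists>g. path g \<and> path_image g \<subseteq> model_torus \<and> pathstart g = (- 1, - 1) \<and> pathfinish g = y"
    if y: "y \<in> model_torus" for y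
  proof -
    obtain u where u: "u \<in> grid" "torus_cover u = y" using torus_cover_surj[OF y] .
    obtain m n where "u \<in> cross m n" using grid_cross[OF u(1)] by blast
    moreover have "center m n \<in> cross m n" by (simp add: cross_def)
    ultimately obtain g where g: "path g" "path_image g \<subseteq> cross m n" "pathstart g = center m n" "pathfinish g = u"
      using simply_connected_imp_path_connected[OF simply_connected_cross, of m n]
      unfolding path_connected_def by blast
    have "torus_cover (center m n) = (-1, -1)"
      using torus_cover_periodic[of "(pi, pi)" m n]
      by (simp add: center_def algebra_simps) (simp add: torus_cover_def)
    moreover have "path (torus_cover \<circ> g)"
      using g(1) continuous_on_torus_cover by (rule path_continuous_image)
    moreover have "path_image (torus_cover \<circ> g) \<subseteq> model_torus"
      using g(2) cross_grid torus_cover_in_iff unfolding path_image_compose by blast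
    ultimately show ?thesis
      using g(3,4) u(2) by (intro exI[of _ "torus_cover \<circ> g"]) (simp add: pathstart_compose pathfinish_compose)
  qed
  show "\<forall>x\<in>model_torus. \<forall>y\<in>model_torus.
      \<exists>g. path g \<and> path_image g \<subseteq> model_torus \<and> pathstart g = x \<and> pathfinish g = y"
  proof (intro ballI)
    fix x y assume "x \<in> model_torus" "y \<in> model_torus"
    then obtain g k where "path g" "path_image g \<subseteq> model_torus" "pathstart g = (- 1, - 1)" "pathfinish g = x"
      "path k" "path_image k \<subseteq> model_torus" "pathstart k = (- 1, - 1)" "pathfinish k = y"
      using * by metis
    then show "\<exists>g. path g \<and> path_image g \<subseteq> model_torus \<and> pathstart g = x \<and> pathfinish g = y"
      by (intro exI[of _ "reversepath g +++ k"]) (auto simp: path_image_join)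
  qed
qed

text \<open>
  A path in the grid that stays near a point lies in a simply connected cross, hence is homotopic
  to a polygonal path through the centre of the cross. The polygonal path between two centres,
  in turn, can be moved into rows and columns.
\<close>

locale based_torus = based_paths model_torus x base for x base
begin

abbreviation mult :: "_ \<Rightarrow> _ \<Rightarrow> _" (infixl "\<cdot>" 70) where
  "u \<cdot> v \<equiv> u \<otimes>\<^bsub>fundamental_group model_torus x\<^esub> v"

definition lift_eval :: "(real \<Rightarrow> real \<times> real) \<Rightarrow> (real \<Rightarrow> complex \<times> complex) set" where
  "lift_eval s = eval (torus_cover \<circ> s)"

definition in_grid :: "(real \<Rightarrow> real \<times> real) \<Rightarrow> bool" where
  "in_grid s \<longleftrightarrow> path s \<and> path_image s \<subseteq> grid"

definition line :: "real \<times> real \<Rightarrow> real \<times> real \<Rightarrow> (real \<Rightarrow> complex \<times> complex) set" where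
  "line u v = lift_eval (linepath u v)"

text \<open>The two segments cover the circles w = -1 and z = -1 of the model torus. Their images
  are loops at (-1,-1), which \<open>eval\<close> carries to x along the chosen base path.\<close>

definition edge_group :: "(real \<Rightarrow> complex \<times> complex) set set" where
  "edge_group = generate (fundamental_group model_torus x)
     {line (center 0 0) (center 1 0), line (center 0 0) (center 0 1)}"

lemma path_in_cover: "in_grid s \<Longrightarrow> path_in (torus_cover \<circ> s)"
  using path_continuous_image[OF _ continuous_on_torus_cover] torus_cover_in_iff
  unfolding in_grid_def path_in_def path_image_compose by blast

lemma lift_eval_closed [simp]: "in_grid s \<Longrightarrow> lift_eval s \<in> carrier (fundamental_group model_torus x)"
  unfolding lift_eval_def by (intro eval_closed path_in_cover)

lemma lift_eval_homotopic:
  assumes "homotopic_paths grid s r" shows "lift_eval s = lift_eval r"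
  unfolding lift_eval_def
proof (rule eval_homotopic)
  show "homotopic_paths model_torus (torus_cover \<circ> s) (torus_cover \<circ> r)"
    using assms torus_cover_in_iff
    by (intro homotopic_paths_continuous_image[OF assms continuous_on_torus_cover]) auto
qed

lemma lift_eval_join:
  "\<lbrakk>in_grid s; in_grid r; pathfinish s = pathstart r\<rbrakk> \<Longrightarrow> lift_eval (s +++ r) = lift_eval s \<cdot> lift_eval r"
  unfolding lift_eval_def path_compose_join
  by (intro eval_join path_in_cover) (auto simp: pathstart_compose pathfinish_compose)

lemma in_grid_linepath: "convex K \<Longrightarrow> K \<subseteq> grid \<Longrightarrow> u \<in> K \<Longrightarrow> v \<in> K \<Longrightarrow> in_grid (linepath u v)"
  unfolding in_grid_def by (auto dest: closed_segment_subset)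

lemma line_closed [simp]:
  assumes "convex K" "K \<subseteq> grid" "u \<in> K" "v \<in> K"
  shows "line u v \<in> carrier (fundamental_group model_torus x)"
  unfolding line_def using assms by (intro lift_eval_closed in_grid_linepath)

lemma line_join:
  assumes K: "convex K" "K \<subseteq> grid" "u \<in> K" "v \<in> K" "w \<in> K"
  shows "line u v \<cdot> line v w = line u w"
proof -
  have "homotopic_paths K (id \<circ> (linepath u v +++ linepath v w)) (id \<circ> linepath u w)"
    using K by (intro homotopic_paths_convex_image[where S = K])
      (auto simp: path_image_join dest: closed_segment_subset)
  then have "homotopic_paths grid (linepath u v +++ linepath v w) (linepath u w)"
    using K(2) homotopic_paths_subset by auto
  then show ?thesis
    using lift_eval_homotopic lift_eval_join[of "linepath u v" "linepath v w"] in_grid_linepath K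
    by (simp add: line_def)
qed

lemma line_self:
  assumes "u \<in> grid"
  shows "line u u = \<one>\<^bsub>fundamental_group model_torus x\<^esub>"
proof -
  have "torus_cover \<circ> linepath u u = (\<lambda>_. torus_cover u)"
    by (auto simp: linepath_def fun_eq_iff algebra_simps simp flip: scaleR_left.add)
  then show ?thesis
    using assms torus_cover_in_iff by (simp add: line_def lift_eval_def eval_const)
qed

lemma line_cancel:
  assumes "convex K" "K \<subseteq> grid" "u \<in> K" "v \<in> K"
  shows "line u v \<cdot> line v u = \<one>\<^bsub>fundamental_group model_torus x\<^esub>"
  using line_join[OF assms assms(3)] line_self[OF subsetD[OF assms(2,3)]] by simp

text \<open>Translations by periods are deck transformations, so both segments have the same image
  path.\<close>

lemma line_shift:
  "line (fst u + 2 * pi * of_int m, snd u + 2 * pi * of_int n)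
        (fst v + 2 * pi * of_int m, snd v + 2 * pi * of_int n) = line u v"
proof -
  have "linepath (fst u + 2 * pi * of_int m, snd u + 2 * pi * of_int n)
      (fst v + 2 * pi * of_int m, snd v + 2 * pi * of_int n) t =
      (fst (linepath u v t) + 2 * pi * of_int m, snd (linepath u v t) + 2 * pi * of_int n)" for t
    by (simp add: linepath_def prod_eq_iff algebra_simps)
  then have "torus_cover \<circ> linepath (fst u + 2 * pi * of_int m, snd u + 2 * pi * of_int n)
      (fst v + 2 * pi * of_int m, snd v + 2 * pi * of_int n) = torus_cover \<circ> linepath u v"
    using torus_cover_periodic by (simp add: fun_eq_iff)
  then show ?thesis by (simp add: line_def lift_eval_def)
qed

lemma center_shift: "center m n =
    (fst (center m' n') + 2 * pi * of_int (m - m'), snd (center m' n') + 2 * pi * of_int (n - n'))"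
  by (simp add: center_def algebra_simps)

lemma line_center_shift: "line (center (m + k) (n + l)) (center (m' + k) (n' + l)) = line (center m n) (center m' n')"
  using line_shift[of "center m n" k l "center m' n'"]
  by (simp add: center_shift[of "m + k" "n + l" m n] center_shift[of "m' + k" "n' + l" m' n'])

lemma subgroup_edge_group: "subgroup edge_group (fundamental_group model_torus x)"
  unfolding edge_group_def
  using line_closed[OF convex_column column_grid center_in(1) center_in(1)]
    line_closed[OF convex_row row_grid center_in(2) center_in(2)]
  by (intro generate_is_subgroup) auto

lemma edge_groupI:
  "line (center 0 0) (center 1 0) \<in> edge_group" "line (center 0 0) (center 0 1) \<in> edge_group"
  unfolding edge_group_def by (auto intro: generate.incl)

text \<open>Inside a convex set lines between consecutive points telescope, and backward lines are
  inverses, so single steps suffice. It is used for the centres in one row and in one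
  column.\<close>

lemma subgroup_chain:
  assumes sub: "subgroup N (fundamental_group model_torus x)"
    and K: "convex K" "K \<subseteq> grid" "\<And>k::int. z k \<in> K" and step: "\<And>k. line (z k) (z (k + 1)) \<in> N"
  shows "line (z i) (z j) \<in> N"
proof -
  have up: "line (z i) (z (i + int k)) \<in> N" for i k
  proof (induction k)
    case 0
    then show ?case
      using line_self[OF subsetD[OF K(2) K(3)]] subgroup.one_closed[OF sub] by simp
  next
    case (Suc k)
    have "line (z i) (z (i + int k)) \<cdot> line (z (i + int k)) (z (i + int k + 1)) = line (z i) (z (i + int k + 1))"
      using K by (intro line_join)
    then show ?case
      using Suc step subgroup.m_closed[OF sub] by (metis add.assoc add.commute of_nat_Suc)
  qed
  show ?thesis
  proof (cases "i \<le> j")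
    case True
    then show ?thesis using up[of i "nat (j - i)"] by simp
  next
    case False
    then have "line (z j) (z i) \<in> N" using up[of j "nat (i - j)"] by simp
    moreover have "line (z i) (z j) = inv\<^bsub>fundamental_group model_torus x\<^esub> line (z j) (z i)"
      using line_cancel[OF K(1,2) K(3) K(3)] line_closed[OF K(1,2) K(3) K(3)]
      by (metis inv_equality)
    ultimately show ?thesis using subgroup.m_inv_closed[OF sub] by simp
  qed
qed

lemma line_row: "line (center m n) (center m' n) \<in> edge_group"
proof (rule subgroup_chain[OF subgroup_edge_group convex_row row_grid])
  show "line (center k n) (center (k + 1) n) \<in> edge_group" for k
    using edge_groupI(1) line_center_shift[of 0 k 0 n 1 0] by (simp add: add.commute)
qed (rule center_in(2))

lemma line_column: "line (center m n) (center m n') \<in> edge_group"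
proof (rule subgroup_chain[OF subgroup_edge_group convex_column column_grid])
  show "line (center m k) (center m (k + 1)) \<in> edge_group" for k
    using edge_groupI(2) line_center_shift[of 0 m 0 k 0 1] by (simp add: add.commute)
qed (rule center_in(1))

lemma line_via_column:
  assumes "u \<in> column m"
  shows "line (center m n) u \<cdot> line u (center m n') \<in> edge_group"
  using line_join[OF convex_column column_grid center_in(1) assms center_in(1)] line_column by simp

lemma line_via_row:
  assumes "u \<in> row n"
  shows "line (center m n) u \<cdot> line u (center m' n) \<in> edge_group"
  using line_join[OF convex_row row_grid center_in(2) assms center_in(2)] line_row by simp

lemma cross_line_closed:
  assumes "u \<in> cross m n"
  shows "line (center m n) u \<in> carrier (fundamental_group model_torus x)"
    "line u (center m n) \<in> carrier (fundamental_group model_torus x)"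
    "line u (center m n) \<cdot> line (center m n) u = \<one>\<^bsub>fundamental_group model_torus x\<^esub>"
    "line (center m n) u \<cdot> line u (center m n) = \<one>\<^bsub>fundamental_group model_torus x\<^esub>"
  using assms line_closed[OF convex_column column_grid] line_closed[OF convex_row row_grid]
    line_cancel[OF convex_column column_grid] line_cancel[OF convex_row row_grid]
  unfolding cross_def by (metis UnE center_in)+

lemma telescope:
  assumes "a \<in> carrier (fundamental_group model_torus x)" "b \<in> carrier (fundamental_group model_torus x)"
    "c \<in> carrier (fundamental_group model_torus x)" "d \<in> carrier (fundamental_group model_torus x)"
    "b \<cdot> c = \<one>\<^bsub>fundamental_group model_torus x\<^esub>"
  shows "(a \<cdot> b) \<cdot> (c \<cdot> d) = a \<cdot> d"
proof -
  have "(a \<cdot> b) \<cdot> (c \<cdot> d) = a \<cdot> ((b \<cdot> c) \<cdot> d)"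
    using assms(1-4) by (simp add: m_assoc)
  then show ?thesis using assms by simp
qed

text \<open>If u lies in a strip common to both crosses, the detour through u is a straight line
  between centres. Otherwise u lies in a column of one cross and a row of the other, and the route
  turns at the centre where these two strips meet.\<close>

lemma line_via_cross:
  assumes "u \<in> cross m n" "u \<in> cross m' n'"
  shows "line (center m n) u \<cdot> line u (center m' n') \<in> edge_group"
proof -
  have turn: ?thesis if uw: "u \<in> cross i j" "line (center m n) u \<cdot> line u (center i j) \<in> edge_group"
    "line (center i j) u \<cdot> line u (center m' n') \<in> edge_group" for i j
    using subgroup.m_closed[OF subgroup_edge_group uw(2,3)] cross_line_closed[OF uw(1)]
      cross_line_closed[OF assms(1)] cross_line_closed[OF assms(2)] by (simp add: telescope)
  consider "u \<in> column m" "u \<in> column m'" | "u \<in> row n" "u \<in> row n'"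
    | "u \<in> column m" "u \<in> row n'" | "u \<in> row n" "u \<in> column m'"
    using assms by (auto simp: cross_def)
  then show ?thesis
  proof cases
    case 1
    then have "m = m'" using column_unique[of u m u m'] by simp
    then show ?thesis using 1 line_via_column by simp
  next
    case 2
    then have "n = n'" using row_unique[of u n u n'] by simp
    then show ?thesis using 2 line_via_row by simp
  next
    case 3
    then show ?thesis using turn[of m n'] line_via_column line_via_row by (auto simp: cross_def)
  next
    case 4
    then show ?thesis using turn[of m' n] line_via_column line_via_row by (auto simp: cross_def)
  qed
qed

text \<open>The ends of a path need not be centres, so lines to centres are attached. Quantifying
  over all crosses that contain an end allows two paths to be joined through any cross around their
  common point.\<close>

definition good :: "(real \<Rightarrow> real \<times> real) \<Rightarrow> bool" where
  "good s \<longleftrightarrow> in_grid s \<and> (\<forall>m n m' n'. pathstart s \<in> cross m n \<longrightarrow> pathfinish s \<in> cross m' n' \<longrightarrow>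
     line (center m n) (pathstart s) \<cdot> lift_eval s \<cdot> line (pathfinish s) (center m' n') \<in> edge_group)"

lemma good_homotopic: "homotopic_paths grid s r \<Longrightarrow> good s \<Longrightarrow> good r"
  using lift_eval_homotopic[of s r] homotopic_paths_imp_pathstart[of grid s r]
    homotopic_paths_imp_pathfinish[of grid s r] homotopic_paths_imp_path[of grid s r]
    homotopic_paths_imp_subset[of grid s r]
  by (simp add: good_def in_grid_def)

lemma good_join:
  assumes s: "good s" and r: "good r" and sr: "pathfinish s = pathstart r"
  shows "good (s +++ r)"
  unfolding good_def
proof (intro conjI allI impI)
  have g: "in_grid s" "in_grid r" using s r by (auto simp: good_def)
  then show "in_grid (s +++ r)" using sr by (auto simp: in_grid_def path_image_join)
  have "pathfinish s \<in> grid" using g by (auto simp: in_grid_def)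
  then obtain i j where ij: "pathfinish s \<in> cross i j" using grid_cross by blast
  fix m n m' n' assume e: "pathstart (s +++ r) \<in> cross m n" "pathfinish (s +++ r) \<in> cross m' n'"
  then have e': "pathstart s \<in> cross m n" "pathfinish r \<in> cross m' n'" by auto
  note c = cross_line_closed[OF ij] cross_line_closed[OF e'(1)] cross_line_closed[OF e'(2)]
    lift_eval_closed[OF g(1)] lift_eval_closed[OF g(2)]
  have 1: "line (center m n) (pathstart s) \<cdot> lift_eval s \<cdot> line (pathfinish s) (center i j) \<in> edge_group"
    using s e' ij by (simp add: good_def)
  have 2: "line (center i j) (pathfinish s) \<cdot> (lift_eval r \<cdot> line (pathfinish r) (center m' n')) \<in> edge_group"
    using r e' ij c unfolding good_def sr by (simp flip: m_assoc)
  show "line (center m n) (pathstart (s +++ r)) \<cdot> lift_eval (s +++ r)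
      \<cdot> line (pathfinish (s +++ r)) (center m' n') \<in> edge_group"
    using subgroup.m_closed[OF subgroup_edge_group 1 2] c
      telescope[of "line (center m n) (pathstart s) \<cdot> lift_eval s" "line (pathfinish s) (center i j)"
        "line (center i j) (pathfinish s)" "lift_eval r \<cdot> line (pathfinish r) (center m' n')"]
    by (simp add: lift_eval_join[OF g sr]) (simp add: m_assoc)
qed

text \<open>A cross is simply connected, so the path may be replaced by two segments through its
  centre. Each segment, with the line attached at its outer end, is an instance of
  \<open>line_via_cross\<close>.\<close>

lemma good_cross:
  assumes s: "path s" "path_image s \<subseteq> cross i j"
  shows "good s"
  unfolding good_def
proof (intro conjI allI impI)
  show g: "in_grid s" using s cross_grid by (auto simp: in_grid_def)
  let ?a = "pathstart s" and ?b = "pathfinish s" and ?c = "center i j"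
  have ab: "?a \<in> cross i j" "?b \<in> cross i j" using s by auto
  have c: "?c \<in> cross i j" by (simp add: cross_def)
  have seg: "path_image (linepath ?a ?c) \<subseteq> cross i j" "path_image (linepath ?c ?b) \<subseteq> cross i j"
    using ab closed_segment_subset[OF _ _ convex_column, of _ i] closed_segment_subset[OF _ _ convex_row, of _ j]
    unfolding cross_def path_image_linepath by (metis Un_iff center_in subset_trans Un_upper1 Un_upper2)+
  have gl: "in_grid (linepath ?a ?c)" "in_grid (linepath ?c ?b)"
    using subset_trans[OF seg(1) cross_grid] subset_trans[OF seg(2) cross_grid]
    by (simp_all add: in_grid_def)
  have "homotopic_paths (cross i j) s (linepath ?a ?c +++ linepath ?c ?b)"
    using simply_connected_cross[of i j] s seg unfolding simply_connected_eq_homotopic_paths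
    by (auto simp: path_image_join)
  then have "homotopic_paths grid s (linepath ?a ?c +++ linepath ?c ?b)"
    using cross_grid by (rule homotopic_paths_subset)
  then have eq: "lift_eval s = line ?a ?c \<cdot> line ?c ?b"
    using gl by (simp add: lift_eval_homotopic lift_eval_join line_def)
  fix m n m' n' assume e: "?a \<in> cross m n" "?b \<in> cross m' n'"
  have "(line (center m n) ?a \<cdot> line ?a ?c) \<cdot> (line ?c ?b \<cdot> line ?b (center m' n')) \<in> edge_group"
    using line_via_cross[OF e(1) ab(1)] line_via_cross[OF ab(2) e(2)] subgroup.m_closed[OF subgroup_edge_group]
    by blast
  then show "line (center m n) ?a \<cdot> lift_eval s \<cdot> line ?b (center m' n') \<in> edge_group"
    using cross_line_closed[OF ab(1)] cross_line_closed[OF ab(2)] cross_line_closed[OF e(1)]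
      cross_line_closed[OF e(2)] by (simp add: eq m_assoc)
qed

text \<open>By uniform continuity the path splits into N pieces on each of which points are less
  than 3 apart. Each piece lies in one cross, and the pieces are joined one after the other.\<close>

lemma good_all:
  assumes s: "in_grid s"
  shows "good s"
proof -
  have s1: "path s" "path_image s \<subseteq> grid" using s by (auto simp: in_grid_def)
  have "uniformly_continuous_on {0..1} s"
    using s1 by (intro compact_uniformly_continuous) (auto simp: path_def)
  then obtain d where d: "d > 0"
    "\<And>t t'. \<lbrakk>t \<in> {0..1}; t' \<in> {0..1}; dist t' t < d\<rbrakk> \<Longrightarrow> dist (s t') (s t) < 3"
    unfolding uniformly_continuous_on_def by (metis zero_less_numeral)
  obtain N :: nat where N: "N > 0" "1 / real N < d"
    using d(1) by (metis nat_approx_posE zero_less_Suc)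
  have small: "good (subpath a b s)" if ab: "0 \<le> a" "a \<le> b" "b \<le> 1" "b - a < d" for a b
  proof -
    have img: "path_image (subpath a b s) = s ` {a..b}"
      using ab by (simp add: path_image_subpath)
    have "s ` {a..b} \<subseteq> grid" using s1(2) ab by (auto simp: path_image_def)
    moreover have "dist u v < 3" if "u \<in> s ` {a..b}" "v \<in> s ` {a..b}" for u v
      using that ab by (auto simp: dist_real_def intro!: d(2))
    ultimately obtain i j where "s ` {a..b} \<subseteq> cross i j"
      by (rule small_set_in_cross)
    then show ?thesis
      using ab s1 img by (intro good_cross[of _ i j]) (auto intro: path_subpath)
  qed
  have "good (subpath 0 (real k / real N) s)" if "k \<le> N" for k
    using that
  proof (induction k)
    case 0
    then show ?case using small[of 0 0] d by simp
  next
    case (Suc k)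
    let ?a = "real k / real N" and ?b = "real (Suc k) / real N"
    have ab: "0 \<le> ?a" "?a \<le> ?b" "?b \<le> 1" "?b - ?a < d"
      using Suc.prems N by (auto simp: field_simps)
    have "good (subpath 0 ?a s +++ subpath ?a ?b s)"
      using Suc ab small by (intro good_join) auto
    moreover have "homotopic_paths grid (subpath 0 ?a s +++ subpath ?a ?b s) (subpath 0 ?b s)"
      using s1 ab by (intro homotopic_join_subpaths) auto
    ultimately show ?case by (rule good_homotopic[rotated])
  qed
  from this[of N] show ?thesis using N by simp
qed

text \<open>Points of one fibre differ by periods, and translation by periods carries crosses to
  crosses without changing the values of lines.\<close>

lemma same_fibre:
  assumes uv: "torus_cover u = torus_cover v" and v: "v \<in> cross m n"
  obtains k l where "u \<in> cross (m + k) (n + l)"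
    "line (center (m + k) (n + l)) u = line (center m n) v"
    "line u (center (m + k) (n + l)) = line v (center m n)"
proof -
  have "\<exists>k::int. fst u = fst v + 2 * pi * of_int k" "\<exists>l::int. snd u = snd v + 2 * pi * of_int l"
    using uv sin_cos_eq_iff[of "fst u" "fst v"] sin_cos_eq_iff[of "snd u" "snd v"]
    by (auto simp: torus_cover_def complex_eq_iff)
  then obtain k l :: int where u: "u = (fst v + 2 * pi * of_int k, snd v + 2 * pi * of_int l)"
    by (metis prod.collapse)
  have c: "center (m + k) (n + l) =
      (fst (center m n) + 2 * pi * of_int k, snd (center m n) + 2 * pi * of_int l)"
    using center_shift[of "m + k" "n + l" m n] by simp
  show ?thesis
  proof
    show "u \<in> cross (m + k) (n + l)"
      using v by (simp add: u cross_def column_def row_def algebra_simps)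
    show "line (center (m + k) (n + l)) u = line (center m n) v"
      "line u (center (m + k) (n + l)) = line v (center m n)"
      unfolding c u by (rule line_shift)+
  qed
qed

text \<open>The lift of a loop at x need not be closed, but both its ends lie over x, so by
  \<open>same_fibre\<close> the lines attached there have the same values as at u0. Hence
  \<open>good_all\<close> puts the conjugate of each class by \<open>?g\<close> into
  \<open>edge_group\<close>, and every element of the group is such a conjugate.\<close>

theorem fundamental_group_generated:
  "carrier (fundamental_group model_torus x) = edge_group"
proof
  show "edge_group \<subseteq> carrier (fundamental_group model_torus x)"
    using subgroup_edge_group by (rule subgroup.subset)
  obtain u0 where u0: "u0 \<in> grid" "torus_cover u0 = x" using torus_cover_surj[OF x_in] .
  obtain m n where mn: "u0 \<in> cross m n" using grid_cross[OF u0(1)] by blast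
  let ?g = "line (center m n) u0" and ?G = "fundamental_group model_torus x"
  have g: "?g \<in> carrier ?G" "line u0 (center m n) = inv\<^bsub>?G\<^esub> ?g"
    using cross_line_closed[OF mn] inv_equality[OF cross_line_closed(3,1,2)[OF mn]] by simp_all
  have conj: "?g \<cdot> y \<cdot> inv\<^bsub>?G\<^esub> ?g \<in> edge_group" if y0: "y \<in> carrier ?G" for y
  proof -
    obtain p where p: "loop_at model_torus x p" "y = eval p" using y0 carrier_eq_eval by auto
    obtain s where s: "path s" "path_image s \<subseteq> grid" "\<And>t. t \<in> {0..1} \<Longrightarrow> p t = torus_cover (s t)"
      using torus_path_lift p(1) by (metis loop_atD(1,2))
    have s01: "torus_cover (pathstart s) = torus_cover u0" "torus_cover (pathfinish s) = torus_cover u0"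
      using s(3)[of 0] s(3)[of 1] p(1) u0(2) by (auto simp: loop_at_def pathstart_def pathfinish_def)
    have grid: "in_grid s" using s by (simp add: in_grid_def)
    have "homotopic_paths model_torus p (torus_cover \<circ> s)"
      using p(1) s(3) by (intro homotopic_paths_eq) (auto simp: loop_at_def)
    then have y: "y = lift_eval s"
      using p(2) eval_homotopic by (simp add: lift_eval_def)
    obtain k l where kl: "pathstart s \<in> cross (m + k) (n + l)"
      "line (center (m + k) (n + l)) (pathstart s) = ?g"
      using same_fibre[OF s01(1) mn] by metis
    obtain k' l' where kl': "pathfinish s \<in> cross (m + k') (n + l')"
      "line (pathfinish s) (center (m + k') (n + l')) = line u0 (center m n)"
      using same_fibre[OF s01(2) mn] by metis
    show ?thesis
      using good_all[OF grid] kl kl' g(2) unfolding good_def y by metis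
  qed
  show "carrier ?G \<subseteq> edge_group"
  proof
    fix y assume y: "y \<in> carrier ?G"
    have "?g \<cdot> (inv\<^bsub>?G\<^esub> ?g \<cdot> y \<cdot> ?g) \<cdot> inv\<^bsub>?G\<^esub> ?g = y"
      using y g(1) by (simp add: m_assoc inv_mult_cancel)
    then show "y \<in> edge_group"
      using conj[of "inv\<^bsub>?G\<^esub> ?g \<cdot> y \<cdot> ?g"] y g(1) by simp
  qed
qed

end

section \<open>Punctured torus bundles\<close>

lemma fundamental_group_map_hom:
  assumes f: "continuous_on S f" "f ` S \<subseteq> S'"
  shows "fundamental_group_map f S' \<in> hom (fundamental_group S x) (fundamental_group S' (f x))"
proof (rule homI)
  fix u assume "u \<in> carrier (fundamental_group S x)"
  then obtain p where p: "u = path_class S p" "loop_at S x p" by (auto simp: carrier_fundamental_group)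
  then show "fundamental_group_map f S' u \<in> carrier (fundamental_group S' (f x))"
    using loop_at_compose[OF p(2) f] fundamental_group_map_class[OF f] path_class_in_carrier
    by (simp add: loop_at_def)
next
  fix u v assume "u \<in> carrier (fundamental_group S x)" "v \<in> carrier (fundamental_group S x)"
  then obtain p r where p: "u = path_class S p" "loop_at S x p" and r: "v = path_class S r" "loop_at S x r"
    by (auto simp: carrier_fundamental_group)
  have "fundamental_group_map f S' (path_class S l) = path_class S' (f \<circ> l)" if "loop_at S x l" for l
    using that fundamental_group_map_class[OF f] by (simp add: loop_at_def)
  then show "fundamental_group_map f S' (u \<otimes>\<^bsub>fundamental_group S x\<^esub> v) =
      fundamental_group_map f S' u \<otimes>\<^bsub>fundamental_group S' (f x)\<^esub> fundamental_group_map f S' v"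
    using p r loop_at_join[OF p(2) r(2)] loop_at_compose[OF p(2) f] loop_at_compose[OF r(2) f]
    by (simp add: mult_fundamental_group path_compose_join)
qed

lemma model_torus_two_generated:
  assumes "x \<in> model_torus"
  obtains a b where "a \<in> carrier (fundamental_group model_torus x)"
    "b \<in> carrier (fundamental_group model_torus x)"
    "carrier (fundamental_group model_torus x) = generate (fundamental_group model_torus x) {a, b}"
proof -
  obtain base where "based_paths model_torus x base"
    using based_paths_exist[OF path_connected_model_torus assms] .
  then interpret based_torus x base by (simp add: based_torus_def)
  show ?thesis
    using that fundamental_group_generated edge_groupI unfolding edge_group_def by auto
qed

locale torus_bundle =
  fixes T :: "'t::topological_space set" and x :: 't and h h' :: "'t \<Rightarrow> 't"
    and M :: "'m::topological_space set" and q :: "'t \<times> real \<Rightarrow> 'm"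
  assumes x_in: "x \<in> T" and homeo: "homeomorphism T T h h'" and h_x: "h x = x"
    and mapping_torus: "mapping_torus T h M q"
begin

abbreviation fibre :: "'t \<Rightarrow> 'm" where
  "fibre y \<equiv> q (y, 0)"

lemma q_continuous: "continuous_on (T \<times> {0..1}) q" "q ` (T \<times> {0..1}) \<subseteq> M"
proof -
  have "quotient_map (top_of_set (T \<times> {0..1})) (top_of_set M) q"
    using mapping_torus by (simp add: mapping_torus_def)
  then have "continuous_map (top_of_set (T \<times> {0..1})) (top_of_set M) q"
    by (rule quotient_imp_continuous_map)
  then show "continuous_on (T \<times> {0..1}) q" "q ` (T \<times> {0..1}) \<subseteq> M"
    by (simp_all add: image_subset_iff_funcset)
qed

lemma h_in: "y \<in> T \<Longrightarrow> h y \<in> T" "y \<in> T \<Longrightarrow> h' y \<in> T" "y \<in> T \<Longrightarrow> h (h' y) = y"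
  and h_continuous: "continuous_on T h" "continuous_on T h'"
  and h_image: "h ` T \<subseteq> T" "h' ` T \<subseteq> T"
  and h'_x: "h' x = x"
  using homeo h_x x_in by (auto simp: homeomorphism_def)

lemma q_glue:
  assumes "y \<in> T" shows "q (y, 1) = q (h y, 0)"
proof -
  have "equivclp (\<lambda>u v. \<exists>y\<in>T. u = (y, 1) \<and> v = (h y, 0)) (y, 1::real) (h y, 0::real)"
    using assms by (intro r_into_equivclp) auto
  moreover have "(y, 1::real) \<in> T \<times> {0..1}" "(h y, 0::real) \<in> T \<times> {0..1}"
    using assms h_in(1) by auto
  ultimately show ?thesis
    using mapping_torus unfolding mapping_torus_def by blast
qed

lemma fibre_continuous: "continuous_on T fibre" "fibre ` T \<subseteq> M"
proof -
  show "continuous_on T fibre"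
    by (rule continuous_on_compose2[OF q_continuous(1)]) (auto intro!: continuous_intros)
  show "fibre ` T \<subseteq> M" using q_continuous(2) by auto
qed

abbreviation pi1 :: "(real \<Rightarrow> 'm) set monoid" where
  "pi1 \<equiv> fundamental_group M (fibre x)"

sublocale pi1: group pi1
  using fibre_continuous(2) x_in by (intro group_fundamental_group) auto

lemma loop_at_fibre: "loop_at T x p \<Longrightarrow> loop_at M (fibre x) (fibre \<circ> p)"
  using loop_at_compose[OF _ fibre_continuous] .

lemma loop_at_h: "loop_at T x p \<Longrightarrow> loop_at T x (h \<circ> p)"
  using loop_at_compose[OF _ h_continuous(1) h_image(1)] h_x by metis

lemma loop_at_h': "loop_at T x p \<Longrightarrow> loop_at T x (h' \<circ> p)"
  using loop_at_compose[OF _ h_continuous(2) h_image(2)] h'_x by metis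

lemma fibre_class: "loop_at T x p \<Longrightarrow> fundamental_group_map fibre M (path_class T p) = path_class M (fibre \<circ> p)"
  using fundamental_group_map_class[OF fibre_continuous] by (simp add: loop_at_def)

lemma fibre_subgroup_eq: "fibre_subgroup T x M q = {path_class M (fibre \<circ> p) | p. loop_at T x p}"
  unfolding fibre_subgroup_def carrier_fundamental_group using fibre_class by auto

text \<open>The vertical path over x is a loop because \<open>h\<close> fixes x. Conjugation by its
  class undoes \<open>h\<close> on the fibre, so the reversed path is taken to obtain the action of
  \<open>h\<close> itself.\<close>

definition stable_letter :: "(real \<Rightarrow> 'm) set" where
  "stable_letter = path_class M (reversepath (\<lambda>s. q (x, s)))"

lemma loop_at_suspension: "loop_at M (fibre x) (\<lambda>s. q (x, s))"
proof -
  have "continuous_on {0..1} (\<lambda>s. q (x, s))"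
    by (rule continuous_on_compose2[OF q_continuous(1)]) (use x_in in \<open>auto intro!: continuous_intros\<close>)
  then show ?thesis
    using q_continuous(2) q_glue[OF x_in] h_x x_in
    by (auto simp: loop_at_def path_def path_image_def pathstart_def pathfinish_def)
qed

text \<open>The homotopy is the image of the square under \<open>(u, s) \<mapsto> q (p u, s)\<close>.\<close>

lemma suspension_conj:
  assumes p: "loop_at T x p"
  shows "path_class M (\<lambda>s. q (x, s)) \<otimes>\<^bsub>pi1\<^esub> path_class M (fibre \<circ> (h \<circ> p)) \<otimes>\<^bsub>pi1\<^esub>
      inv\<^bsub>pi1\<^esub> path_class M (\<lambda>s. q (x, s)) = path_class M (fibre \<circ> p)"
proof -
  let ?S = "{0..1::real} \<times> {0..1::real}" and ?f = "\<lambda>u. q (p (fst u), snd u)" and ?t = "\<lambda>s. q (x, s)"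
  have pt: "p u \<in> T" if "u \<in> {0..1}" for u
    using p that by (auto simp: loop_at_def path_image_def)
  have p01: "p 0 = x" "p 1 = x" using p by (auto simp: loop_at_def pathstart_def pathfinish_def)
  have pc: "continuous_on {0..1} p" using p by (simp add: loop_at_def path_def)
  have "continuous_on ?S (\<lambda>u. p (fst u))"
    by (rule continuous_on_compose2[OF pc]) (auto intro!: continuous_intros)
  then have f: "continuous_on ?S ?f"
    by (intro continuous_on_compose2[OF q_continuous(1)] continuous_intros) (use pt in auto)
  have fM: "?f ` ?S \<subseteq> M" using q_continuous(2) pt by auto
  let ?l = "linepath (0, 0) (0, 1) :: real \<Rightarrow> real \<times> real"
    and ?u = "linepath (0, 1) (1, 1) :: real \<Rightarrow> real \<times> real"
    and ?r = "linepath (1, 1) (1, 0) :: real \<Rightarrow> real \<times> real"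
    and ?d = "linepath (0, 0) (1, 0) :: real \<Rightarrow> real \<times> real"
  have conv: "convex ?S" by (intro convex_Times) auto
  have seg: "path_image (linepath a b) \<subseteq> ?S" if "a \<in> ?S" "b \<in> ?S" for a b
    using that conv by (simp add: closed_segment_subset)
  \<comment> \<open>Left, top and right side of the square, run in this order, are homotopic to the
    bottom side.\<close>
  have "homotopic_paths M (?f \<circ> ((?l +++ ?u) +++ ?r)) (?f \<circ> ?d)"
    using seg by (intro homotopic_paths_convex_image[OF conv f fM]) (auto simp: path_image_join)
  then have hom: "homotopic_paths M (((?f \<circ> ?l) +++ (?f \<circ> ?u)) +++ (?f \<circ> ?r)) (?f \<circ> ?d)"
    by (simp add: path_compose_join)
  have l: "?f \<circ> ?l = ?t" and r: "?f \<circ> ?r = reversepath ?t" and d: "?f \<circ> ?d = fibre \<circ> p"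
    by (auto simp: fun_eq_iff linepath_def p01 reversepath_def)
  have loops: "loop_at M (fibre x) ?t" "loop_at M (fibre x) (fibre \<circ> (h \<circ> p))"
    using loop_at_suspension loop_at_fibre[OF loop_at_h[OF p]] .
  \<comment> \<open>The top side lies at height 1, where the gluing turns it into
    \<open>h \<circ> p\<close> in the fibre over 0.\<close>
  have "(fibre \<circ> (h \<circ> p)) t = (?f \<circ> ?u) t" if "t \<in> {0..1}" for t
    using q_glue[OF pt[OF that]] by (simp add: linepath_def)
  then have up: "homotopic_paths M (fibre \<circ> (h \<circ> p)) (?f \<circ> ?u)"
    by (rule homotopic_paths_eq[OF loop_atD(1,2)[OF loops(2)]])
  note t = loop_atD[OF loops(1)] and fhp = loop_atD[OF loops(2)]
  have "homotopic_paths M ?t ?t" "homotopic_paths M (reversepath ?t) (reversepath ?t)"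
    using t(1,2) by simp_all
  then have "homotopic_paths M ((?t +++ (fibre \<circ> (h \<circ> p))) +++ reversepath ?t)
      (((?f \<circ> ?l) +++ (?f \<circ> ?u)) +++ (?f \<circ> ?r))"
    unfolding l r
    by (intro homotopic_paths_join up) (simp_all only: pathfinish_join pathstart_reversepath t fhp)
  from homotopic_paths_trans[OF this hom]
  have "homotopic_paths M ((?t +++ (fibre \<circ> (h \<circ> p))) +++ reversepath ?t) (fibre \<circ> p)"
    unfolding d .
  then have "path_class M ((?t +++ (fibre \<circ> (h \<circ> p))) +++ reversepath ?t) = path_class M (fibre \<circ> p)"
    by (rule path_class_eq)
  then show ?thesis
    using loops by (simp add: inv_fundamental_group mult_fundamental_group loop_at_join loop_at_reversepath)
qed

lemma stable_letter_closed: "stable_letter \<in> carrier pi1"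
  "inv\<^bsub>pi1\<^esub> stable_letter = path_class M (\<lambda>s. q (x, s))"
  using loop_at_suspension loop_at_reversepath[OF loop_at_suspension]
  by (auto simp: stable_letter_def path_class_in_carrier inv_fundamental_group)

lemma stable_letter_conj:
  assumes p: "loop_at T x p"
  shows "stable_letter \<otimes>\<^bsub>pi1\<^esub> path_class M (fibre \<circ> p) \<otimes>\<^bsub>pi1\<^esub> inv\<^bsub>pi1\<^esub> stable_letter =
    path_class M (fibre \<circ> (h \<circ> p))"
proof -
  have c: "path_class M (fibre \<circ> (h \<circ> p)) \<in> carrier pi1"
    using loop_at_fibre[OF loop_at_h[OF p]] by (rule path_class_in_carrier)
  have eq: "inv\<^bsub>pi1\<^esub> stable_letter \<otimes>\<^bsub>pi1\<^esub> path_class M (fibre \<circ> (h \<circ> p)) \<otimes>\<^bsub>pi1\<^esub> stable_letter =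
      path_class M (fibre \<circ> p)"
    using suspension_conj[OF p] stable_letter_closed by (metis pi1.inv_inv)
  show ?thesis
    unfolding eq[symmetric] using c stable_letter_closed(1)
    by (simp add: pi1.m_assoc pi1.inv_mult_cancel)
qed

lemma normalizes_stable_letter:
  "pi1.normalizes stable_letter (fibre_subgroup T x M q)"
  "pi1.normalizes (inv\<^bsub>pi1\<^esub> stable_letter) (fibre_subgroup T x M q)"
proof -
  show "pi1.normalizes stable_letter (fibre_subgroup T x M q)"
    using stable_letter_closed stable_letter_conj loop_at_h
    unfolding pi1.normalizes_def fibre_subgroup_eq by auto
  have "inv\<^bsub>pi1\<^esub> stable_letter \<otimes>\<^bsub>pi1\<^esub> path_class M (fibre \<circ> p) \<otimes>\<^bsub>pi1\<^esub> inv\<^bsub>pi1\<^esub> (inv\<^bsub>pi1\<^esub> stable_letter)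
      = path_class M (fibre \<circ> (h' \<circ> p))" if p: "loop_at T x p" for p
  proof -
    \<comment> \<open>The two functions agree on the unit interval, but outside it p may leave
      \<open>T\<close>; so a homotopy takes the place of equality.\<close>
    have "homotopic_paths M (fibre \<circ> p) (fibre \<circ> (h \<circ> (h' \<circ> p)))"
      using loop_at_fibre[OF p] p h_in(3) unfolding loop_at_def path_image_def
      by (intro homotopic_paths_eq) (auto simp: image_subset_iff path_image_def)
    then have "path_class M (fibre \<circ> p) = path_class M (fibre \<circ> (h \<circ> (h' \<circ> p)))"
      by (rule path_class_eq)
    then show ?thesis
      using suspension_conj[OF loop_at_h'[OF p]] stable_letter_closed(2) by simp
  qed
  then show "pi1.normalizes (inv\<^bsub>pi1\<^esub> stable_letter) (fibre_subgroup T x M q)"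
    using pi1.inv_closed[OF stable_letter_closed(1)] loop_at_h'
    unfolding pi1.normalizes_def fibre_subgroup_eq by auto
qed

end

text \<open>The homeomorphism from the model followed by the inclusion of the fibre induces a
  homomorphism onto the fibre subgroup, and the images of two generators generate its image.\<close>

lemma fibre_two_generated:
  assumes tb: "torus_bundle T x h h' M q"
    and f: "homeomorphism model_torus T f g" and y: "y \<in> model_torus" "x = f y"
  obtains a b where "a \<in> carrier (fundamental_group M (q (x, 0)))"
    "b \<in> carrier (fundamental_group M (q (x, 0)))"
    "fibre_subgroup T x M q = generate (fundamental_group M (q (x, 0))) {a, b}"
proof -
  interpret torus_bundle T x h h' M q by (rule tb)
  let ?Q = "fundamental_group model_torus y" and ?F = "fibre \<circ> f"
  let ?m = "fundamental_group_map ?F M"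
  have fc: "continuous_on model_torus f" "f ` model_torus \<subseteq> T" "continuous_on T g" "g ` T \<subseteq> model_torus"
    and fg: "\<And>z. z \<in> T \<Longrightarrow> f (g z) = z" and gx: "g x = y"
    using f y by (auto simp: homeomorphism_def)
  have F: "continuous_on model_torus ?F" "?F ` model_torus \<subseteq> M"
    using continuous_on_compose[OF fc(1)] continuous_on_subset[OF fibre_continuous(1) fc(2)]
      fc(2) fibre_continuous(2) by (auto simp: comp_def)
  have hom: "?m \<in> hom ?Q pi1"
    using fundamental_group_map_hom[OF F, of y] y by (simp add: comp_def)
  have "group ?Q" using group_fundamental_group[OF y(1)] .
  then interpret group_hom ?Q pi1 ?m
    using hom by (simp add: group_hom_def group_hom_axioms_def pi1.group_axioms)
  obtain a b where ab: "a \<in> carrier ?Q" "b \<in> carrier ?Q" "carrier ?Q = generate ?Q {a, b}"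
    using model_torus_two_generated[OF y(1)] .
  have "?m ` carrier ?Q = generate pi1 (?m ` {a, b})"
    using generate_img[of "{a, b}"] ab by auto
  moreover have "?m ` carrier ?Q = fibre_subgroup T x M q"
  proof -
    have m: "?m (path_class model_torus p) = path_class M (fibre \<circ> (f \<circ> p))"
      if "loop_at model_torus y p" for p
      using that fundamental_group_map_class[OF F] by (simp add: loop_at_def o_assoc)
    have "fibre_subgroup T x M q \<subseteq> ?m ` carrier ?Q"
    proof
      fix u assume "u \<in> fibre_subgroup T x M q"
      then obtain p where p: "u = path_class M (fibre \<circ> p)" "loop_at T x p"
        by (auto simp: fibre_subgroup_eq)
      have gp: "loop_at model_torus y (g \<circ> p)"
        using loop_at_compose[OF p(2) fc(3,4)] gx by simp
      have "homotopic_paths M (fibre \<circ> p) (fibre \<circ> (f \<circ> (g \<circ> p)))"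
        using loop_at_fibre[OF p(2)] p(2) fg unfolding loop_at_def
        by (intro homotopic_paths_eq) (auto simp: image_subset_iff path_image_def)
      then have "u = ?m (path_class model_torus (g \<circ> p))"
        using p(1) m[OF gp] path_class_eq by metis
      then show "u \<in> ?m ` carrier ?Q" using path_class_in_carrier[OF gp] by blast
    qed
    moreover have "?m ` carrier ?Q \<subseteq> fibre_subgroup T x M q"
      using m loop_at_compose[OF _ fc(1,2)] y(2)
      unfolding carrier_fundamental_group fibre_subgroup_eq by fastforce
    ultimately show ?thesis by blast
  qed
  ultimately show ?thesis
    using that[of "?m a" "?m b"] ab hom_closed by simp
qed

theorem theorem1p4:
  fixes T B :: "'t::topological_space set" and x :: 't and h :: "'t \<Rightarrow> 't"
    and M :: "'m::topological_space set" and q :: "'t \<times> real \<Rightarrow> 'm"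
    and A :: "int^2^2"
    and P :: "(real \<Rightarrow> 'm) set monoid"
    and lt :: "(real \<Rightarrow> 'm) set \<Rightarrow> (real \<Rightarrow> 'm) set \<Rightarrow> bool"
    and G G2 G3 C :: "(real \<Rightarrow> 'm) set set"
  assumes "punctured_torus T B" and "x \<in> B"
    and "monodromy T B h"
    and "mapping_torus T h M q"
    and "represents_on_H1 T h A" and "hyperbolic A" and "untwisted A"
    and "P = fundamental_group M (q (x, 0))"
    and "G = fibre_subgroup T x M q"
    and "G2 = commutator_subgroup P G G"
    and "G3 = commutator_subgroup P G2 G"
    and "bi_ordering P lt"
    and "maximal_convex_subgroup (P\<lparr>carrier := G2\<rparr>) (restrict_order lt G2) C"
  shows "C = G3"
proof -
  obtain f g where f: "homeomorphism model_torus T f g" and B: "B = f ` model_boundary"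
    using assms(1) by (auto simp: punctured_torus_def)
  obtain h' where h': "homeomorphism T T h h'" and hB: "\<And>y. y \<in> B \<Longrightarrow> h y = y"
    using assms(3) by (auto simp: monodromy_def)
  obtain y where "y \<in> model_boundary" and xy: "x = f y" using assms(2) B by blast
  then have y: "y \<in> model_torus" by (auto simp: model_torus_def model_boundary_def)
  have T: "f ` model_torus = T" "continuous_on model_torus f" using f by (auto simp: homeomorphism_def)
  have tb: "torus_bundle T x h h' M q"
    using h' hB assms(2,4) y xy T by unfold_locales auto
  interpret torus_bundle T x h h' M q by (rule tb)
  have P: "P = fundamental_group M (fibre x)" by (rule assms(8))
  obtain a b where ab: "a \<in> carrier P" "b \<in> carrier P" "G = generate P {a, b}"
    using fibre_two_generated[OF tb f y xy] unfolding P assms(9) .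
  have "path_connected T"
    using path_connected_continuous_image[OF T(2) path_connected_model_torus] T(1) by simp
  then obtain base where "based_paths T x base"
    using based_paths_exist[OF _ x_in] by blast
  then interpret b: based_paths T x base .
  \<comment> \<open>Pulled back to the fundamental group of \<open>T\<close>, invariance under the
    stable letter becomes invariance under \<open>h\<close> by \<open>stable_letter_conj\<close>, so
    that \<open>invariant_character_trivial\<close> applies.\<close>
  have char: "\<forall>u\<in>G. \<kappa> u = 0"
    if add: "\<And>u v. \<lbrakk>u \<in> G; v \<in> G\<rbrakk> \<Longrightarrow> \<kappa> (u \<otimes>\<^bsub>P\<^esub> v) = \<kappa> u + \<kappa> v"
      and inv: "\<And>u. u \<in> G \<Longrightarrow> \<kappa> (stable_letter \<otimes>\<^bsub>P\<^esub> u \<otimes>\<^bsub>P\<^esub> inv\<^bsub>P\<^esub> stable_letter) = \<kappa> u" for \<kappa> :: "_ \<Rightarrow> real"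
  proof
    let ?m = "fundamental_group_map fibre M"
    have inG: "?m u \<in> G" if "u \<in> carrier (fundamental_group T x)" for u
      using that by (simp add: assms(9) fibre_subgroup_def)
    have cls: "path_class M (fibre \<circ> p) \<in> G" if "loop_at T x p" for p
      using that by (auto simp: assms(9) fibre_subgroup_eq)
    fix u assume "u \<in> G"
    then obtain l where l: "u = path_class M (fibre \<circ> l)" "loop_at T x l"
      by (auto simp: assms(9) fibre_subgroup_eq)
    have "\<kappa> (?m (path_class T l)) = 0"
    proof (rule b.invariant_character_trivial[OF _ homeo h_x _ assms(5,6) l(2)])
      fix u v assume uv: "u \<in> carrier (fundamental_group T x)" "v \<in> carrier (fundamental_group T x)"
      then show "\<kappa> (?m (u \<otimes>\<^bsub>fundamental_group T x\<^esub> v)) = \<kappa> (?m u) + \<kappa> (?m v)"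
        using hom_mult[OF fundamental_group_map_hom[OF fibre_continuous] uv] add inG by (simp add: P)
    next
      fix p assume p: "loop_at T x p"
      then show "\<kappa> (?m (path_class T (h \<circ> p))) = \<kappa> (?m (path_class T p))"
        using inv[OF cls[OF p]] stable_letter_conj[OF p] fibre_class[OF p] fibre_class[OF loop_at_h[OF p]]
        by (simp add: P)
    qed
    then show "\<kappa> u = 0" using fibre_class l by simp
  qed
  show ?thesis
    using group.maximal_convex_eq_third_lower_central[OF _ assms(12) ab(1-3) assms(10,11) _ _ char assms(13)]
      pi1.group_axioms normalizes_stable_letter
    unfolding P assms(9) by blast
qed

end
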